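(* Let $(X(t),\Lambda(t))$ be the regime-switching jump diffusion on $\mathbb{R}^d\times\mathcal{M}$ with generator $\mathcal{G}$ described in the context, under the standing assumptions listed there. Let $D\subset\mathbb{R}^d$ be a bounded domain. Suppose that for each $i\in\mathcal{M}$ there exists a nonnegative function $V(\cdot,i)\in C^2(\mathbb{R}^d)$ such that $$\mathcal{G}V(x,i)\le -1\quad\text{for all }(x,i)\in D^c\times\mathcal{M}.$$ Then $(X(t),\Lambda(t))$ is positive recurrent with respect to $U=D\times\mathcal{M}$.
   Context: A domain in $\mathbb{R}^d$ is a nonempty connected open set. $B(x,r)$ is the open ball of radius $r$ centered at $x$; $D^c=\mathbb{R}^d\setminus D$. $\mathcal{M}=\{1,\dots,m\}$ is a finite set. $C^2_b(\mathbb{R}^d)$ is the class of $C^2$ functions whose partial derivatives up to order 2 (including order 0) are bounded. Data: $b:\mathbb{R}^d\times\mathcal{M}\to\mathbb{R}^d$; $\sigma$ on $\mathbb{R}^d\times\mathcal{M}$ with values in $d\times d$ real matrices; $a(x,i)=\sigma(x,i)\sigma(x,i)'$; for each $(x,i)$ a $\sigma$-finite measure $\pi_i(x,dz)$ on $\mathbb{R}^d$ with $\int(1\wedge|z|^2)\pi_i(x,dz)<\infty$; and an $m\times m$ matrix $Q(x)=(q_{ij}(x))$ with $q_{ij}(x)\ge0$ for $i\ne j$ and $\sum_{j}q_{ij}(x)=0$. For $f:\mathbb{R}^d\times\mathcal{M}\to\mathbb{R}$ with each $f(\cdot,i)\in C^2(\mathbb{R}^d)$, the generator is $$\mathcal{G}f(x,i)=\tfrac12\sum_{k,l=1}^d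 a_{kl}(x,i)\tfrac{\partial^2 f(x,i)}{\partial x_k\partial x_l}+\sum_{k=1}^d b_k(x,i)\tfrac{\partial f(x,i)}{\partial x_k}+\int_{\mathbb{R}^d}\big(f(x+z,i)-f(x,i)-\nabla f(x,i)\cdot z\,\mathbf{1}_{\{|z|<1\}}\big)\pi_i(x,dz)+\sum_{j\in\mathcal{M}}q_{ij}(x)f(x,j).$$ Standing assumptions: (1) For each $i$, $\sigma(\cdot,i)$ and $b(\cdot,i)$ are continuous, and $\sum_{k,l}|\sigma_{kl}(x,i)|+\sum_k|b_k(x,i)|\le c(1+|x|)$ on $\mathbb{R}^d$ for some $c>0$; each $q_{ij}$ is bounded and Borel measurable on $\mathbb{R}^d$. (2) For every bounded domain $D\subset\mathbb{R}^d$ there is $\kappa_0=\kappa_0(D)\in(0,1]$ with $\kappa_0|\xi|^2\le\xi'a(x,i)\xi\le\kappa_0^{-1}|\xi|^2$ for all $\xi\in\mathbb{R}^d$, $x\in D$, $i\in\mathcal{M}$. (3) $\sup_{x\in\mathbb{R}^d,i\in\mathcal{M}}\pi_i(x,B(0,1)^c)<\infty$, and for some $c>0$, $\sup_{i\in\mathcal{M}}\int_{B(0,1)}|z|^2\pi_i(x,dz)\le c(1+|x|^2)$ for all $x$. For every $n\ge1$ there is a $\sigma$-finite measure $\Pi_n(dz)$ with $\int(1\wedge|z|^2)\Pi_n(dz)<\infty$ and $\pi_i(x,dz)\le\Pi_n(dz)$ for all $x\in B(0,n)$, $i\in\mathcal{M}$. (4) $\pi_i(x,dz)=\widetilde\pi_i(x,z)\,dz$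 for all $i,x$. For any $r\in(0,1)$, any $x_0\in\mathbb{R}^d$, any $x,y\in B(x_0,r/2)$ and $z\in B(x_0,r)^c$, $\widetilde\pi_i(x,z-x)\le\alpha_r\widetilde\pi_i(y,z-y)$, where $1<\alpha_r<\kappa_2r^{-\beta}$ with $\kappa_2,\beta$ positive constants. The process: $\mathbb{P}_{x,i}$ is the law, on the Skorohod space of right-continuous paths with left limits in $\mathbb{R}^d\times\mathcal{M}$, of the solution of the martingale problem for $(\mathcal{G},C^2_b(\mathbb{R}^d))$ started at $(x,i)$: $\mathbb{P}_{x,i}(X(0)=x,\Lambda(0)=i)=1$, and for every $f$ with $f(\cdot,j)\in C_b^2(\mathbb{R}^d)$ for all $j$, $f(X(t),\Lambda(t))-f(X(0),\Lambda(0))-\int_0^t\mathcal{G}f(X(s),\Lambda(s))ds$ is a $\mathbb{P}_{x,i}$-martingale. Under the standing assumptions this solution is known to exist and be unique for each $(x,i)$, and $(X(t),\Lambda(t))$ is a strong Markov process with infinite lifetime (no explosion). $\mathbb{E}_{x,i}$ is expectation under $\mathbb{P}_{x,i}$. Recurrence: for $U=D\times J$ with $D\subset\mathbb{R}^d$ a bounded domain and $J\subset\mathcal{M}$, let $\sigma_U=\inf\{t\ge0:(X(t),\Lambda(t))\in U\}$. The process is recurrent with respect to $U$ if $\mathbb{P}_{x,i}(\sigma_U<\infty)=1$ for all $(x,i)\in U^c$; it is positive recurrent with respect to $U$ if in addition $\mathbb{E}_{x,i}\sigma_U<\infty$ for all $(x,i)\in U^c$. *)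

theory Defs
  imports "HOL-Probability.Probability"
begin

section \<open>Functions of class C2\<close>

definition partial :: "'n::finite \<Rightarrow> (real^'n \<Rightarrow> real) \<Rightarrow> real^'n \<Rightarrow> real" where
  "partial k f x = frechet_derivative f (at x) (axis k 1)"

definition gradient :: "(real^'n::finite \<Rightarrow> real) \<Rightarrow> real^'n \<Rightarrow> real^'n" where
  "gradient f x = (\<chi> k. partial k f x)"

definition C1 :: "(real^'n::finite \<Rightarrow> real) \<Rightarrow> bool" where
  "C1 f \<longleftrightarrow> (\<forall>x. f differentiable (at x)) \<and> (\<forall>k. continuous_on UNIV (partial k f))"

definition C2 :: "(real^'n::finite \<Rightarrow> real) \<Rightarrow> bool" where
  "C2 f \<longleftrightarrow> C1 f \<and> (\<forall>k. C1 (partial k f))"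

definition C2b :: "(real^'n::finite \<Rightarrow> real) \<Rightarrow> bool" where
  "C2b f \<longleftrightarrow> C2 f \<and> bounded (range f) \<and> (\<forall>k. bounded (range (partial k f))) \<and>
     (\<forall>k l. bounded (range (partial k (partial l f))))"

definition bounded_domain :: "('a::metric_space) set \<Rightarrow> bool" where
  "bounded_domain D \<longleftrightarrow> D \<noteq> {} \<and> open D \<and> connected D \<and> bounded D"

section \<open>Coefficients and generator\<close>

text \<open>The regimes are the elements of the finite type \<^typ>\<open>'m\<close>, and \<open>Q x $ i $ j\<close> is the
  switching rate from \<open>i\<close> to \<open>j\<close> at \<open>x\<close>.\<close>

definition diffusion_matrix ::
    "(real^'n::finite \<Rightarrow> 'm \<Rightarrow> real^'n^'n) \<Rightarrow> real^'n \<Rightarrow> 'm \<Rightarrow> real^'n^'n" where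
  "diffusion_matrix \<sigma> x i = \<sigma> x i ** transpose (\<sigma> x i)"

definition jump_integrand ::
    "(real^'n::finite \<Rightarrow> 'm \<Rightarrow> real) \<Rightarrow> real^'n \<Rightarrow> 'm \<Rightarrow> real^'n \<Rightarrow> real" where
  "jump_integrand f x i z =
     f (x + z) i - f x i - (gradient (\<lambda>y. f y i) x \<bullet> z) * indicator {z. norm z < 1} z"

text \<open>The Bochner integral below is 0 by convention when the integrand is not integrable, so for
  unbounded \<open>f\<close> a claim about \<open>generator\<close> at \<open>(x, i)\<close> is meaningful only together with
  \<open>generator_defined\<close> at \<open>(x, i)\<close>.\<close>

definition generator_defined ::
    "('m \<Rightarrow> real^'n::finite \<Rightarrow> (real^'n) measure) \<Rightarrow> (real^'n \<Rightarrow> 'm \<Rightarrow> real) \<Rightarrow>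
     real^'n \<Rightarrow> 'm \<Rightarrow> bool" where
  "generator_defined \<pi> f x i \<longleftrightarrow> integrable (\<pi> i x) (jump_integrand f x i)"

definition generator ::
    "(real^'n::finite \<Rightarrow> 'm::finite \<Rightarrow> real^'n^'n) \<Rightarrow> (real^'n \<Rightarrow> 'm \<Rightarrow> real^'n) \<Rightarrow>
     ('m \<Rightarrow> real^'n \<Rightarrow> (real^'n) measure) \<Rightarrow> (real^'n \<Rightarrow> real^'m^'m) \<Rightarrow>
     (real^'n \<Rightarrow> 'm \<Rightarrow> real) \<Rightarrow> real^'n \<Rightarrow> 'm \<Rightarrow> real" where
  "generator \<sigma> b \<pi> Q f x i =
     1/2 * (\<Sum>k\<in>UNIV. \<Sum>l\<in>UNIV.
        diffusion_matrix \<sigma> x i $ k $ l * partial k (partial l (\<lambda>y. f y i)) x)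
     + (\<Sum>k\<in>UNIV. b x i $ k * partial k (\<lambda>y. f y i) x)
     + (LINT z|\<pi> i x. jump_integrand f x i z)
     + (\<Sum>j\<in>UNIV. Q x $ i $ j * f x j)"

definition levy_measure :: "(real^'n::finite) measure \<Rightarrow> bool" where
  "levy_measure \<mu> \<longleftrightarrow> sets \<mu> = sets borel \<and> sigma_finite_measure \<mu> \<and>
     (\<integral>\<^sup>+ z. ennreal (min 1 ((norm z)\<^sup>2)) \<partial>\<mu>) < \<infinity>"

locale regime_switching_coefficients =
  fixes \<sigma> :: "real^'n::finite \<Rightarrow> 'm::finite \<Rightarrow> real^'n^'n"
    and b :: "real^'n \<Rightarrow> 'm \<Rightarrow> real^'n"
    and \<pi> :: "'m \<Rightarrow> real^'n \<Rightarrow> (real^'n) measure"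
    and Q :: "real^'n \<Rightarrow> real^'m^'m"
  assumes levy: "\<And>x i. levy_measure (\<pi> i x)"
    and Q_offdiag: "\<And>x i j. i \<noteq> j \<Longrightarrow> 0 \<le> Q x $ i $ j"
    and Q_row_sum: "\<And>x i. (\<Sum>j\<in>UNIV. Q x $ i $ j) = 0"
    and sigma_cont: "\<And>i. continuous_on UNIV (\<lambda>x. \<sigma> x i)"
    and b_cont: "\<And>i. continuous_on UNIV (\<lambda>x. b x i)"
    and linear_growth: "\<And>i. \<exists>c>0. \<forall>x.
      (\<Sum>k\<in>UNIV. \<Sum>l\<in>UNIV. \<bar>\<sigma> x i $ k $ l\<bar>) + (\<Sum>k\<in>UNIV. \<bar>b x i $ k\<bar>) \<le> c * (1 + norm x)"
    and Q_bounded: "\<And>i j. bounded (range (\<lambda>x. Q x $ i $ j))"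
    and Q_borel: "\<And>i j. (\<lambda>x. Q x $ i $ j) \<in> borel_measurable borel"
    and elliptic: "\<And>D. bounded_domain D \<Longrightarrow> \<exists>\<kappa>\<^sub>0::real. 0 < \<kappa>\<^sub>0 \<and> \<kappa>\<^sub>0 \<le> 1 \<and>
      (\<forall>\<xi>. \<forall>x\<in>D. \<forall>i.
         \<kappa>\<^sub>0 * (norm \<xi>)\<^sup>2 \<le> \<xi> \<bullet> (diffusion_matrix \<sigma> x i *v \<xi>) \<and>
         \<xi> \<bullet> (diffusion_matrix \<sigma> x i *v \<xi>) \<le> inverse \<kappa>\<^sub>0 * (norm \<xi>)\<^sup>2)"
    and big_jumps: "(SUP (x, i)\<in>UNIV. emeasure (\<pi> i x) (- ball 0 1)) < \<infinity>"
    and small_jumps: "\<exists>c>0. \<forall>x.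
      (SUP i. \<integral>\<^sup>+ z\<in>ball 0 1. ennreal ((norm z)\<^sup>2) \<partial>\<pi> i x) \<le> ennreal (c * (1 + (norm x)\<^sup>2))"
    and local_domination: "\<And>n::nat. 1 \<le> n \<Longrightarrow> \<exists>\<mu>. levy_measure \<mu> \<and>
      (\<forall>x\<in>ball 0 (real n). \<forall>i. \<forall>A\<in>sets borel. emeasure (\<pi> i x) A \<le> emeasure \<mu> A)"
    and jump_density: "\<exists>(p :: 'm \<Rightarrow> real^'n \<Rightarrow> real^'n \<Rightarrow> real) (\<alpha> :: real \<Rightarrow> real) \<kappa>\<^sub>2 \<beta>.
      0 < \<kappa>\<^sub>2 \<and> 0 < \<beta> \<and>
      (\<forall>i x. p i x \<in> borel_measurable borel \<and> (\<forall>z. 0 \<le> p i x z) \<and>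
             \<pi> i x = density lborel (\<lambda>z. ennreal (p i x z))) \<and>
      (\<forall>r. 0 < r \<and> r < 1 \<longrightarrow> 1 < \<alpha> r \<and> \<alpha> r < \<kappa>\<^sub>2 * r powr (- \<beta>) \<and>
         (\<forall>i x\<^sub>0. \<forall>x\<in>ball x\<^sub>0 (r/2). \<forall>y\<in>ball x\<^sub>0 (r/2). \<forall>z\<in>- ball x\<^sub>0 r.
            p i x (z - x) \<le> \<alpha> r * p i y (z - y)))"

section \<open>Path space and martingale problem\<close>

text \<open>A path is a function on \<open>{0..}\<close>, made extensional by the product space.  The regimes carry
  the discrete topology, so convergence of the second component means being eventually constant.\<close>

definition cadlag :: "(real \<Rightarrow> (real^'n::finite) \<times> 'm) \<Rightarrow> bool" where
  "cadlag \<omega> \<longleftrightarrow>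
     (\<forall>t\<ge>0. ((\<lambda>s. fst (\<omega> s)) \<longlongrightarrow> fst (\<omega> t)) (at_right t) \<and>
            (\<forall>\<^sub>F s in at_right t. snd (\<omega> s) = snd (\<omega> t))) \<and>
     (\<forall>t>0. (\<exists>x. ((\<lambda>s. fst (\<omega> s)) \<longlongrightarrow> x) (at_left t)) \<and>
            (\<exists>i. \<forall>\<^sub>F s in at_left t. snd (\<omega> s) = i))"

definition state_space :: "((real^'n::finite) \<times> 'm::finite) measure" where
  "state_space = borel \<Otimes>\<^sub>M count_space UNIV"

text \<open>The Borel sigma-algebra of the Skorohod topology is the one generated by the coordinate
  maps.\<close>

definition skorohod_space :: "(real \<Rightarrow> (real^'n::finite) \<times> 'm::finite) measure" where
  "skorohod_space = restrict_space (PiM {0..} (\<lambda>_. state_space)) {\<omega>. cadlag \<omega>}"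

definition path_filtration ::
    "real \<Rightarrow> (real \<Rightarrow> (real^'n::finite) \<times> 'm::finite) measure" where
  "path_filtration t =
     vimage_algebra (space skorohod_space) (\<lambda>\<omega>. restrict \<omega> {0..t}) (PiM {0..t} (\<lambda>_. state_space))"

definition martingale :: "'a measure \<Rightarrow> (real \<Rightarrow> 'a measure) \<Rightarrow> (real \<Rightarrow> 'a \<Rightarrow> real) \<Rightarrow> bool" where
  "martingale P F M \<longleftrightarrow>
     (\<forall>t\<ge>0. M t \<in> borel_measurable (F t) \<and> integrable P (M t)) \<and>
     (\<forall>s t. 0 \<le> s \<and> s \<le> t \<longrightarrow> (AE \<omega> in P. real_cond_exp P (F s) (M t) \<omega> = M s \<omega>))"

text \<open>The \<open>set_integrable\<close> clause only says that the time integral in the martingale exists.\<close>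

definition solves_martingale_problem ::
    "(real^'n::finite \<Rightarrow> 'm::finite \<Rightarrow> real^'n^'n) \<Rightarrow> (real^'n \<Rightarrow> 'm \<Rightarrow> real^'n) \<Rightarrow>
     ('m \<Rightarrow> real^'n \<Rightarrow> (real^'n) measure) \<Rightarrow> (real^'n \<Rightarrow> real^'m^'m) \<Rightarrow>
     real^'n \<Rightarrow> 'm \<Rightarrow> (real \<Rightarrow> (real^'n) \<times> 'm) measure \<Rightarrow> bool" where
  "solves_martingale_problem \<sigma> b \<pi> Q x i P \<longleftrightarrow>
     prob_space P \<and> sets P = sets skorohod_space \<and> \<P>(\<omega> in P. \<omega> 0 = (x, i)) = 1 \<and>
     (\<forall>f. (\<forall>j. C2b (\<lambda>y. f y j)) \<longrightarrow>
        (AE \<omega> in P. \<forall>t\<ge>0.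
           set_integrable lborel {0..t} (\<lambda>s. case \<omega> s of (y, j) \<Rightarrow> generator \<sigma> b \<pi> Q f y j)) \<and>
        martingale P path_filtration
          (\<lambda>t \<omega>. case_prod f (\<omega> t) - case_prod f (\<omega> 0)
             - (LINT s:{0..t}|lborel. (case \<omega> s of (y, j) \<Rightarrow> generator \<sigma> b \<pi> Q f y j))))"

section \<open>Recurrence\<close>

definition hitting_time :: "'s set \<Rightarrow> (real \<Rightarrow> 's) \<Rightarrow> ennreal" where
  "hitting_time U \<omega> = (INF t\<in>{t. 0 \<le> t \<and> \<omega> t \<in> U}. ennreal t)"

definition recurrent ::
    "(real^'n::finite \<Rightarrow> 'm \<Rightarrow> (real \<Rightarrow> (real^'n) \<times> 'm) measure) \<Rightarrow> ((real^'n) \<times> 'm) set \<Rightarrow> bool" where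
  "recurrent P U \<longleftrightarrow> (\<forall>(x, i)\<in>- U. \<P>(\<omega> in P x i. hitting_time U \<omega> < \<infinity>) = 1)"

definition positive_recurrent ::
    "(real^'n::finite \<Rightarrow> 'm \<Rightarrow> (real \<Rightarrow> (real^'n) \<times> 'm) measure) \<Rightarrow> ((real^'n) \<times> 'm) set \<Rightarrow> bool" where
  "positive_recurrent P U \<longleftrightarrow>
     recurrent P U \<and> (\<forall>(x, i)\<in>- U. (\<integral>\<^sup>+ \<omega>. hitting_time U \<omega> \<partial>P x i) < \<infinity>)"

end

theory Submission
  imports Defs
begin

text \<open>Cut \<open>V\<close> off to \<open>f = V \<phi>\<close> with \<open>\<phi> = 1\<close> near the ball of radius \<open>n\<close>.  As \<open>f \<le> V\<close> everywhere and
  \<open>f = V\<close> near that ball, only the jump integral changes, and it decreases; so the generator of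
  \<open>f\<close> is at most \<open>-1\<close> on the ball outside \<open>D\<close>.  Sampling the martingale of \<open>f\<close> on a fine grid
  up to the time \<open>\<tau>\<close> of entering \<open>D\<close> or leaving the ball gives
  \<open>E (min \<tau> n) \<le> f x i \<le> V x i\<close>, and \<open>n \<rightarrow> \<infinity>\<close> by monotone convergence, since paths are
  bounded on bounded time intervals.\<close>

section \<open>Calculus of C1 and C2 functions\<close>

text \<open>The martingale problem speaks only about \<open>C2b\<close> test functions, while
  \<open>V\<close> may grow without bound; this forces the cutoff, and with it the ball.
  Nonnegativity of \<open>V\<close> enters twice: it makes the product with a cutoff between 0 and 1
  at most \<open>V\<close>, and it lets the terminal value of the stopped process be dropped, so
  that only the starting value remains in the bound. Comparing the jump integrals of
  \<open>f\<close> and \<open>V\<close> requires both to be genuine integrals, which for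
  \<open>V\<close> is the role of \<open>generator_defined\<close>. On a grid the process may enter
  \<open>D\<close> or leave the ball during the last cell, where the Lyapunov inequality says
  nothing; an upper bound \<open>C\<close> for the generator of \<open>f\<close> on the whole space
  controls that cell. This \<open>C\<close> depends on the cutoff, hence on the ball, so the mesh
  tends to 0 for a fixed ball and only then does the ball grow; the bound \<open>V x i\<close>
  depends on neither.\<close>

lemma partial_eqI: "(f has_derivative F) (at x) \<Longrightarrow> partial k f x = F (axis k 1)"
  unfolding partial_def using frechet_derivative_at by metis

lemma C1I:
  assumes "\<And>x. (f has_derivative F x) (at x)"
    and "\<And>k. continuous_on UNIV (\<lambda>x. F x (axis k 1))"
  shows "C1 f"
proof -
  have "partial k f = (\<lambda>x. F x (axis k 1))" for k
    using partial_eqI[OF assms(1)] by auto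
  then show ?thesis
    unfolding C1_def using assms by (auto simp: differentiable_def)
qed

lemma C1_has_derivative_frechet:
  "C1 f \<Longrightarrow> (f has_derivative frechet_derivative f (at x)) (at x)"
  by (simp add: C1_def frechet_derivative_works)

lemma C1_has_derivative:
  assumes "C1 f"
  shows "(f has_derivative (\<lambda>h. gradient f x \<bullet> h)) (at x)"
proof -
  have d: "(f has_derivative frechet_derivative f (at x)) (at x)"
    by (rule C1_has_derivative_frechet[OF assms])
  interpret linear "frechet_derivative f (at x)"
    using d has_derivative_linear by blast
  have "frechet_derivative f (at x) h = gradient f x \<bullet> h" for h
  proof -
    have "frechet_derivative f (at x) h =
        frechet_derivative f (at x) (\<Sum>k\<in>UNIV. h $ k *\<^sub>R axis k 1)"
      using basis_expansion[of h] by (simp add: scalar_mult_eq_scaleR)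
    also have "\<dots> = (\<Sum>k\<in>UNIV. h $ k * partial k f x)"
      by (simp add: sum scale partial_def)
    finally show ?thesis
      by (simp add: gradient_def inner_vec_def mult.commute)
  qed
  then have "frechet_derivative f (at x) = (\<lambda>h. gradient f x \<bullet> h)" by auto
  with d show ?thesis by simp
qed

lemma C1_continuous_on: "C1 f \<Longrightarrow> continuous_on S f"
  by (meson C1_has_derivative continuous_at_imp_continuous_on has_derivative_continuous)

lemma partial_continuous_on: "C1 f \<Longrightarrow> continuous_on UNIV (partial k f)"
  by (simp add: C1_def)

lemma C1_const: "C1 (\<lambda>_. c)"
  by (rule C1I[where F = "\<lambda>_ _. 0"]) auto

lemma partial_const: "partial k (\<lambda>_. c) x = 0"
  by (rule partial_eqI[where F = "\<lambda>_. 0"]) auto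

lemma C1_add_derivative:
  assumes "C1 f" "C1 g"
  shows "((\<lambda>x. f x + g x) has_derivative (\<lambda>h. gradient f x \<bullet> h + gradient g x \<bullet> h)) (at x)"
  by (intro has_derivative_add C1_has_derivative assms)

lemma gradient_axis: "gradient f x \<bullet> axis k 1 = partial k f x"
  by (simp add: gradient_def inner_axis)

lemma C1_add:
  assumes "C1 f" "C1 g" shows "C1 (\<lambda>x. f x + g x)"
  by (rule C1I, rule C1_add_derivative[OF assms], unfold gradient_axis)
    (intro continuous_intros partial_continuous_on assms)

lemma C1_mult_derivative:
  assumes "C1 f" "C1 g"
  shows "((\<lambda>x. f x * g x) has_derivative
    (\<lambda>h. f x * (gradient g x \<bullet> h) + (gradient f x \<bullet> h) * g x)) (at x)"
  by (intro has_derivative_mult C1_has_derivative assms)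

lemma C1_mult:
  assumes "C1 f" "C1 g" shows "C1 (\<lambda>x. f x * g x)"
  by (rule C1I, rule C1_mult_derivative[OF assms], unfold gradient_axis)
    (intro continuous_intros partial_continuous_on C1_continuous_on assms)

lemma C1_compose_derivative:
  assumes "C1 f" "\<And>u. (p has_real_derivative p' u) (at u)"
  shows "((\<lambda>x. p (f x)) has_derivative (\<lambda>h. p' (f x) * (gradient f x \<bullet> h))) (at x)"
  using has_derivative_compose[OF C1_has_derivative[OF assms(1)]
      assms(2)[unfolded has_field_derivative_def]] .

lemma C1_compose:
  assumes "C1 f" "\<And>u. (p has_real_derivative p' u) (at u)" "continuous_on UNIV p'"
  shows "C1 (\<lambda>x. p (f x))"
proof (rule C1I, rule C1_compose_derivative[OF assms(1,2)], unfold gradient_axis)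
  show "continuous_on UNIV (\<lambda>x. p' (f x) * partial k f x)" for k
    using continuous_on_compose2[OF assms(3) C1_continuous_on[OF assms(1)]]
    by (intro continuous_intros partial_continuous_on assms) auto
qed

lemma C2_imp_C1: "C2 f \<Longrightarrow> C1 f" and C2_partial: "C2 f \<Longrightarrow> C1 (partial k f)"
  by (simp_all add: C2_def)

lemma C2_const: "C2 (\<lambda>_. c)"
  by (simp add: C2_def C1_const partial_const[abs_def])

lemma C2_add:
  assumes "C2 f" "C2 g" shows "C2 (\<lambda>x. f x + g x)"
proof -
  have partial: "partial k (\<lambda>x. f x + g x) = (\<lambda>x. partial k f x + partial k g x)" for k
    using partial_eqI[OF C1_add_derivative[OF assms[THEN C2_imp_C1]]] by (auto simp: gradient_axis)
  show ?thesis unfolding C2_def partial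
    by (intro conjI allI C1_add C2_imp_C1 C2_partial assms)
qed

lemma C2_mult:
  assumes "C2 f" "C2 g" shows "C2 (\<lambda>x. f x * g x)"
proof -
  have partial: "partial k (\<lambda>x. f x * g x) = (\<lambda>x. f x * partial k g x + partial k f x * g x)" for k
    using partial_eqI[OF C1_mult_derivative[OF assms[THEN C2_imp_C1]]] by (auto simp: gradient_axis)
  show ?thesis unfolding C2_def partial
    by (intro conjI allI C1_add C1_mult C2_imp_C1 C2_partial assms)
qed

lemma C2_compose:
  assumes f: "C2 f" and p: "\<And>u. (p has_real_derivative p' u) (at u)"
    and p': "\<And>u. (p' has_real_derivative p'' u) (at u)" and "continuous_on UNIV p''"
  shows "C2 (\<lambda>x. p (f x))"
proof -
  have partial: "partial k (\<lambda>x. p (f x)) = (\<lambda>x. p' (f x) * partial k f x)" for k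
    using partial_eqI[OF C1_compose_derivative[OF C2_imp_C1[OF f] p]] by (auto simp: gradient_axis)
  have "isCont p' u" for u by (rule DERIV_isCont[OF p'])
  then have "continuous_on UNIV p'" by (simp add: continuous_at_imp_continuous_on)
  then show ?thesis unfolding C2_def partial
    by (intro conjI allI C1_mult C1_compose[OF C2_imp_C1[OF f] p]
        C1_compose[OF C2_imp_C1[OF f] p' assms(4)] C2_partial f)
qed

lemma C2_norm_square: "C2 (\<lambda>x::real^'n::finite. x \<bullet> x)"
proof -
  have D: "((\<lambda>x::real^'n. x \<bullet> x) has_derivative (\<lambda>h. x \<bullet> h + h \<bullet> x)) (at x)" for x
    by (intro derivative_intros)
  have 1: "C1 (\<lambda>x::real^'n. x \<bullet> x)"
    by (rule C1I, rule D) (intro continuous_intros)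
  have "partial k (\<lambda>x::real^'n. x \<bullet> x) = (\<lambda>x. 2 * x $ k)" for k
    using partial_eqI[OF D] by (auto simp: inner_axis inner_commute)
  moreover have "C1 (\<lambda>x::real^'n. 2 * x $ k)" for k
    by (rule C1I[where F = "\<lambda>_ h. 2 * h $ k"]) (intro derivative_intros bounded_linear_imp_has_derivative
       bounded_linear_vec_nth, simp)
  ultimately show ?thesis using 1 by (simp add: C2_def)
qed

section \<open>Locality of derivatives and compact support\<close>

lemma partial_cong_open:
  assumes "open S" "x \<in> S" "\<And>y. y \<in> S \<Longrightarrow> f y = g y"
  shows "partial k f x = partial k g x"
proof -
  have "(f has_derivative F) (at x) \<longleftrightarrow> (g has_derivative F) (at x)" for F
    using has_derivative_transform_within_open[of f F x UNIV S g]
      has_derivative_transform_within_open[of g F x UNIV S f] assms by auto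
  then show ?thesis by (simp add: partial_def frechet_derivative_def)
qed

lemma gradient_cong_open:
  assumes "open S" "x \<in> S" "\<And>y. y \<in> S \<Longrightarrow> f y = g y"
  shows "gradient f x = gradient g x"
  unfolding gradient_def using partial_cong_open[OF assms] by simp

lemma partial2_cong_open:
  assumes "open S" "x \<in> S" "\<And>y. y \<in> S \<Longrightarrow> f y = g y"
  shows "partial k (partial l f) x = partial k (partial l g) x"
  by (intro partial_cong_open[OF assms(1)] assms(2,3))

lemma bounded_range_compact_support:
  fixes g :: "'a::metric_space \<Rightarrow> real"
  assumes "continuous_on UNIV g" "compact K" "\<And>x. x \<notin> K \<Longrightarrow> g x = 0"
  shows "bounded (range g)"
proof -
  have "bounded (g ` K)"
    using assms continuous_on_subset by (blast intro: compact_imp_bounded compact_continuous_image)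
  moreover have "range g \<subseteq> insert 0 (g ` K)" using assms(3) by blast
  ultimately show ?thesis by (meson bounded_insert bounded_subset)
qed

lemma partial_outside_support:
  assumes "compact K" "\<And>x. x \<notin> K \<Longrightarrow> f x = 0" "x \<notin> K"
  shows "partial k f x = 0"
  using partial_cong_open[of "- K" x f "\<lambda>_. 0" k] assms
  by (simp add: partial_const compact_imp_closed open_Compl)

text \<open>Since \<open>- K\<close> is open and \<open>f\<close> vanishes on it, the first partial
  derivatives vanish there too, and by the same argument so do the second ones. All of them are
  continuous with support in \<open>K\<close>, hence bounded.\<close>

lemma C2b_compact_support:
  assumes f: "C2 f" and K: "compact K" and 0: "\<And>x. x \<notin> K \<Longrightarrow> f x = 0"
  shows "C2b f"
proof -
  note p = partial_outside_support[OF K 0]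
  show ?thesis unfolding C2b_def
    by (intro conjI allI f bounded_range_compact_support[OF _ K] C1_continuous_on C2_imp_C1
        C2_partial partial_continuous_on 0 p partial_outside_support[OF K p])
qed

section \<open>Powers of the positive part and a C2 cutoff\<close>

lemma has_real_derivative_max_power:
  "((\<lambda>u. max 0 u ^ Suc (Suc n)) has_real_derivative real (Suc (Suc n)) * max 0 u ^ Suc n) (at u)"
proof -
  consider "u < 0" | "u = 0" | "u > 0" by linarith
  then show ?thesis
  proof cases
    case 1
    have "((\<lambda>u. 0) has_real_derivative 0) (at u)" by simp
    then have "((\<lambda>u. max 0 u ^ Suc (Suc n)) has_real_derivative 0) (at u)"
      by (rule has_field_derivative_transform_within_open[where S = "{..<0}"]) (use 1 in auto)
    with 1 show ?thesis by simp
  next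
    case 2
    \<comment> \<open>At 0 the difference quotient contains the factor \<open>max 0 h / h\<close>,
      which is 0 or 1; the remaining power has exponent at least 1 and tends to 0.\<close>
    have "((\<lambda>h::real. max 0 h ^ Suc n * (max 0 h / h)) \<longlongrightarrow> 0) (at 0)"
    proof (rule Lim_null_comparison)
      show "\<forall>\<^sub>F h in at 0. norm (max 0 h ^ Suc n * (max 0 h / h)) \<le> max 0 h ^ Suc n"
        by (auto simp: eventually_at_filter max_def intro!: always_eventually)
      show "((\<lambda>h::real. max 0 h ^ Suc n) \<longlongrightarrow> 0) (at 0)"
        by (rule tendsto_eq_intros refl | simp)+
    qed
    then show ?thesis using 2 by (simp add: DERIV_def field_simps)
  next
    case 3
    have "((\<lambda>u. u ^ Suc (Suc n)) has_real_derivative real (Suc (Suc n)) * u ^ Suc n) (at u)"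
      by (rule derivative_eq_intros refl | simp)+
    then have "((\<lambda>u. max 0 u ^ Suc (Suc n)) has_real_derivative real (Suc (Suc n)) * u ^ Suc n) (at u)"
      by (rule has_field_derivative_transform_within_open[where S = "{0<..}"]) (use 3 in auto)
    with 3 show ?thesis by simp
  qed
qed

text \<open>The cube is the lowest integer power of the positive part whose second derivative is
  still continuous.\<close>

lemma C2_max_cube:
  assumes "C2 f" shows "C2 (\<lambda>x. max 0 (f x) ^ 3)"
proof (rule C2_compose[OF assms])
  show "((\<lambda>u::real. max 0 u ^ 3) has_real_derivative 3 * max 0 u ^ 2) (at u)" for u
    using has_real_derivative_max_power[of 1 u] by (simp add: eval_nat_numeral)
  show "((\<lambda>u::real. 3 * max 0 u ^ 2) has_real_derivative 3 * (2 * max 0 u)) (at u)" for u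
    using has_real_derivative_max_power[of 0 u, THEN DERIV_cmult[where c = 3]]
    by (simp add: eval_nat_numeral)
  show "continuous_on UNIV (\<lambda>u::real. 3 * (2 * max 0 u))"
    by (intro continuous_intros)
qed

text \<open>Two nested cubes of positive parts do the work of a smooth bump. The inner one,
  \<open>u\<close>, vanishes on the ball of radius \<open>R\<close>, and beyond radius
  \<open>R + 1\<close> it is at least 1 because the squares of \<open>R + 1\<close> and
  \<open>R\<close> differ by \<open>2 * R + 1\<close>; there the outer positive part
  vanishes.\<close>

lemma C2_cutoff:
  assumes "0 \<le> R"
  obtains \<phi> :: "real^'n::finite \<Rightarrow> real" where "C2 \<phi>" "\<And>x. 0 \<le> \<phi> x" "\<And>x. \<phi> x \<le> 1"
    "\<And>x. norm x \<le> R \<Longrightarrow> \<phi> x = 1" "\<And>x. R + 1 \<le> norm x \<Longrightarrow> \<phi> x = 0"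
proof
  define u :: "real^'n \<Rightarrow> real" where "u x = max 0 (x \<bullet> x + (- R\<^sup>2)) ^ 3" for x
  let ?\<phi> = "\<lambda>x. max 0 (1 + (- 1) * u x) ^ 3"
  have "C2 u" unfolding u_def
    by (intro C2_max_cube C2_add C2_norm_square C2_const)
  then show "C2 ?\<phi>"
    by (intro C2_max_cube C2_add C2_mult C2_const)
  show "0 \<le> ?\<phi> x" for x by simp
  have "0 \<le> u x" for x by (simp add: u_def)
  then show "?\<phi> x \<le> 1" for x by (intro power_le_one) auto
  show "?\<phi> x = 1" if "norm x \<le> R" for x
  proof -
    have "x \<bullet> x \<le> R\<^sup>2" using that by (simp add: dot_square_norm power_mono)
    then have "u x = 0" by (simp add: u_def)
    then show ?thesis by simp
  qed
  show "?\<phi> x = 0" if "R + 1 \<le> norm x" for x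
  proof -
    have "(R + 1)\<^sup>2 \<le> x \<bullet> x" using that assms by (simp add: dot_square_norm power_mono)
    then have "1 \<le> x \<bullet> x + (- R\<^sup>2)" using assms by (simp add: power2_eq_square algebra_simps)
    then have "1 \<le> u x" unfolding u_def by (intro one_le_power) auto
    then show ?thesis by simp
  qed
qed

section \<open>Mean value and second-order Taylor estimates\<close>

lemma C1_mvt:
  assumes "C1 f"
  obtains t where "0 < t" "t < 1" "f (x + z) - f x = gradient f (x + t *\<^sub>R z) \<bullet> z"
proof -
  have "((\<lambda>t. f (x + t *\<^sub>R z)) has_real_derivative gradient f (x + t *\<^sub>R z) \<bullet> z) (at t)" for t
  proof -
    have "((\<lambda>t. x + t *\<^sub>R z) has_derivative (\<lambda>h. h *\<^sub>R z)) (at t)"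
      by (rule derivative_eq_intros refl | simp)+
    from has_derivative_compose[OF this C1_has_derivative[OF assms]]
    show ?thesis by (simp add: has_field_derivative_def mult.commute[of _ "_ \<bullet> _"])
  qed
  from MVT2[of 0 1 "\<lambda>t. f (x + t *\<^sub>R z)", OF _ this]
  show ?thesis using that by auto
qed

lemma norm_gradient_le:
  fixes f :: "real^'n::finite \<Rightarrow> real" and B :: real
  assumes "\<And>k. \<bar>partial k f x\<bar> \<le> B"
  shows "norm (gradient f x) \<le> CARD('n) * B"
  using norm_le_l1_cart[of "gradient f x"] sum_bounded_above[of UNIV "\<lambda>k. \<bar>partial k f x\<bar>" B] assms
  by (simp add: gradient_def)

lemma C1_lipschitz:
  fixes f :: "real^'n::finite \<Rightarrow> real" and B :: real
  assumes "C1 f" "\<And>k x. \<bar>partial k f x\<bar> \<le> B"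
  shows "\<bar>f (x + z) - f x\<bar> \<le> CARD('n) * B * norm z"
proof -
  obtain t where "f (x + z) - f x = gradient f (x + t *\<^sub>R z) \<bullet> z"
    using C1_mvt[OF assms(1)] .
  then show ?thesis
    using Cauchy_Schwarz_ineq2[of "gradient f (x + t *\<^sub>R z)" z]
      mult_right_mono[OF norm_gradient_le[OF assms(2), of "x + t *\<^sub>R z"], of "norm z"] by simp
qed

text \<open>The increment of \<open>f\<close> is an exact gradient term at an intermediate point,
  and the gradient is Lipschitz because the second partial derivatives have a common bound
  \<open>B\<close>. Each passage from components to the Euclidean norm goes through the l1 norm and
  costs a factor \<open>CARD('n)\<close>, hence its square in the constant.\<close>

lemma C2b_taylor:
  fixes f :: "real^'n::finite \<Rightarrow> real"
  assumes "C2b f"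
  obtains K where "0 \<le> K" "\<And>x z. \<bar>f (x + z) - f x - gradient f x \<bullet> z\<bar> \<le> K * (norm z)\<^sup>2"
proof -
  have f: "C2 f" and b: "\<And>k l. bounded (range (partial k (partial l f)))"
    using assms by (auto simp: C2b_def)
  have "bounded (\<Union>k. \<Union>l. range (partial k (partial l f)))"
    by (intro bounded_UN b finite ballI)
  then obtain B where B: "\<And>k l x. \<bar>partial k (partial l f) x\<bar> \<le> B"
    unfolding bounded_iff by auto
  have B0: "0 \<le> B" using B[of undefined undefined undefined] by linarith
  let ?c = "real CARD('n)"
  show ?thesis
  proof
    show "0 \<le> ?c * (?c * B)" using B0 by simp
    fix x z
    obtain t where t: "0 < t" "t < 1" "f (x + z) - f x = gradient f (x + t *\<^sub>R z) \<bullet> z"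
      using C1_mvt[OF C2_imp_C1[OF f]] .
    have "\<bar>partial k f (x + t *\<^sub>R z) - partial k f x\<bar> \<le> ?c * B * norm (t *\<^sub>R z)" for k
      by (rule C1_lipschitz[OF C2_partial[OF f] B])
    also have "?c * B * norm (t *\<^sub>R z) \<le> ?c * B * norm z"
      using t B0 by (intro mult_left_mono) (auto intro: mult_left_le_one_le)
    finally have *: "\<bar>partial k f (x + t *\<^sub>R z) - partial k f x\<bar> \<le> ?c * B * norm z" for k .
    have "norm (gradient f (x + t *\<^sub>R z) - gradient f x) \<le> ?c * (?c * B * norm z)"
      using norm_le_l1_cart[of "gradient f (x + t *\<^sub>R z) - gradient f x"]
        sum_bounded_above[of UNIV "\<lambda>k. \<bar>partial k f (x + t *\<^sub>R z) - partial k f x\<bar>", OF *]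
      by (simp add: gradient_def)
    then have "\<bar>(gradient f (x + t *\<^sub>R z) - gradient f x) \<bullet> z\<bar> \<le> ?c * (?c * B * norm z) * norm z"
      using Cauchy_Schwarz_ineq2 mult_right_mono norm_ge_zero order_trans by meson
    then show "\<bar>f (x + z) - f x - gradient f x \<bullet> z\<bar> \<le> ?c * (?c * B) * (norm z)\<^sup>2"
      using t by (simp add: inner_diff_left power2_eq_square mult.assoc)
  qed
qed

section \<open>Bounds on the generator\<close>

lemma integrable_levy_measure:
  assumes \<mu>: "levy_measure \<mu>" and g: "g \<in> borel_measurable borel"
    and bound: "\<And>z. \<bar>g z\<bar> \<le> K * min 1 ((norm z)\<^sup>2)"
  shows "integrable \<mu> g"
proof (rule integrableI_bounded)
  have s: "sets \<mu> = sets borel" using \<mu> by (simp add: levy_measure_def)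
  note [measurable_cong] = s
  show "g \<in> borel_measurable \<mu>" using g by (simp cong: measurable_cong_sets add: s)
  \<comment> \<open>\<open>axis undefined 1\<close> is a unit vector, where the minimum in
    \<open>bound\<close> equals 1.\<close>
  have "0 \<le> K" using order_trans[OF abs_ge_zero bound[of "axis undefined 1"]] by simp
  have "(\<integral>\<^sup>+ z. norm (g z) \<partial>\<mu>) \<le> (\<integral>\<^sup>+ z. ennreal K * ennreal (min 1 ((norm z)\<^sup>2)) \<partial>\<mu>)"
    using bound \<open>0 \<le> K\<close> by (intro nn_integral_mono) (simp flip: ennreal_mult)
  also have "\<dots> = ennreal K * (\<integral>\<^sup>+ z. ennreal (min 1 ((norm z)\<^sup>2)) \<partial>\<mu>)"
    by (rule nn_integral_cmult) measurable
  also have "\<dots> < \<infinity>" using \<mu> by (simp add: levy_measure_def ennreal_mult_less_top)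
  finally show "(\<integral>\<^sup>+ z. norm (g z) \<partial>\<mu>) < \<infinity>" .
qed

lemma jump_integrand_measurable:
  assumes "C1 (\<lambda>y. f y i)"
  shows "jump_integrand f x i \<in> borel_measurable borel"
proof -
  have [measurable]: "(\<lambda>y. f y i) \<in> borel_measurable borel"
    using C1_continuous_on[OF assms] by (rule borel_measurable_continuous_onI)
  have [measurable]: "(\<lambda>z. f (x + z) i) \<in> borel_measurable borel"
    by (rule measurable_compose[of "\<lambda>z. x + z" _ borel "\<lambda>y. f y i"]) measurable
  show ?thesis unfolding jump_integrand_def[abs_def] by measurable
qed

text \<open>The Taylor estimate covers jumps shorter than 1, where the gradient compensator is
  present; for the others the compensator is absent and twice a bound of \<open>f\<close> suffices.
  That \<open>K\<close> does not depend on \<open>x\<close> is what later bounds the jump integral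
  over the whole space.\<close>

lemma jump_integrand_bound:
  assumes f: "C2b (\<lambda>y. f y i)"
  obtains K where "0 \<le> K" "\<And>x z. \<bar>jump_integrand f x i z\<bar> \<le> K * min 1 ((norm z)\<^sup>2)"
proof -
  obtain K where K: "0 \<le> K"
      "\<And>x z. \<bar>f (x + z) i - f x i - gradient (\<lambda>y. f y i) x \<bullet> z\<bar> \<le> K * (norm z)\<^sup>2"
    by (rule C2b_taylor[OF f]) (rule that)
  obtain B where B: "\<And>x. \<bar>f x i\<bar> \<le> B"
    using f unfolding C2b_def bounded_iff by auto
  show ?thesis
  proof (rule that)
    show "0 \<le> max K (2 * B)" using K by simp
    fix x z
    show "\<bar>jump_integrand f x i z\<bar> \<le> max K (2 * B) * min 1 ((norm z)\<^sup>2)"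
    proof (cases "norm z < 1")
      case True
      then have "(norm z)\<^sup>2 \<le> 1" by (simp add: power_le_one)
      moreover have "K * (norm z)\<^sup>2 \<le> max K (2 * B) * (norm z)\<^sup>2" by (intro mult_right_mono) auto
      ultimately show ?thesis using True K(2)[of x z] by (simp add: jump_integrand_def)
    next
      case False
      then have "1 \<le> (norm z)\<^sup>2" by (simp add: one_le_power)
      then show ?thesis using False B[of x] B[of "x + z"] by (simp add: jump_integrand_def)
    qed
  qed
qed

context regime_switching_coefficients
begin

lemma generator_defined_C2b:
  assumes "C2b (\<lambda>y. f y i)"
  shows "generator_defined \<pi> f x i"
proof -
  have C1: "C1 (\<lambda>y. f y i)" using assms by (simp add: C2b_def C2_imp_C1)
  obtain K where "\<And>x z. \<bar>jump_integrand f x i z\<bar> \<le> K * min 1 ((norm z)\<^sup>2)"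
    by (rule jump_integrand_bound[of f i, OF assms]) (rule that)
  then show ?thesis unfolding generator_defined_def
    by (rule integrable_levy_measure[where g = "jump_integrand f x i",
          OF levy jump_integrand_measurable[of f i, OF C1]])
qed

text \<open>Derivatives at \<open>x\<close> depend only on values near \<open>x\<close>, and the
  switching term on the values at \<open>x\<close> in all regimes; hence \<open>eq\<close> ranges
  over every regime and these terms coincide. The jump term sees distant points, where only
  \<open>le\<close> is available, and monotonicity of the integral needs both integrands
  integrable.\<close>

lemma generator_mono:
  assumes f: "C2b (\<lambda>y. f y i)" and V: "generator_defined \<pi> V x i"
    and le: "\<And>y. f y i \<le> V y i"
    and S: "open S" "x \<in> S" and eq: "\<And>y j. y \<in> S \<Longrightarrow> f y j = V y j"
  shows "generator \<sigma> b \<pi> Q f x i \<le> generator \<sigma> b \<pi> Q V x i"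
proof -
  have g: "gradient (\<lambda>y. f y i) x = gradient (\<lambda>y. V y i) x"
    by (rule gradient_cong_open[OF S eq])
  have "(LINT z|\<pi> i x. jump_integrand f x i z) \<le> (LINT z|\<pi> i x. jump_integrand V x i z)"
  proof (rule integral_mono)
    show "integrable (\<pi> i x) (jump_integrand f x i)" "integrable (\<pi> i x) (jump_integrand V x i)"
      using generator_defined_C2b[of f i, OF f] V by (simp_all add: generator_defined_def)
    show "jump_integrand f x i z \<le> jump_integrand V x i z" for z
      using le S eq by (simp add: jump_integrand_def g)
  qed
  moreover have "partial k (\<lambda>y. f y i) x = partial k (\<lambda>y. V y i) x" for k
    by (rule partial_cong_open[OF S eq])
  moreover have "partial k (partial l (\<lambda>y. f y i)) x = partial k (partial l (\<lambda>y. V y i)) x" for k l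
    by (rule partial2_cong_open[OF S eq])
  ultimately show ?thesis using S eq by (simp add: generator_def)
qed

text \<open>Jumps of length at least 1 contribute at most \<open>K\<close> times their total mass,
  which is uniformly bounded. For shorter jumps the bound \<open>c * (1 + (norm x)\<^sup>2)\<close>
  grows with \<open>x\<close>; but from a point with \<open>\<rho> + 1 < norm x\<close> such a jump
  cannot reach the support of \<open>f\<close>, so the growth matters only on a bounded set.\<close>

lemma jump_integral_bounded:
  assumes f: "C2b (\<lambda>y. f y i)" and supp: "\<And>y. \<rho> < norm y \<Longrightarrow> f y i = 0"
  obtains C where "\<And>x. (LINT z|\<pi> i x. jump_integrand f x i z) \<le> C"
proof -
  obtain K where K: "0 \<le> K" "\<And>x z. \<bar>jump_integrand f x i z\<bar> \<le> K * min 1 ((norm z)\<^sup>2)"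
    by (rule jump_integrand_bound[of f i, OF f]) (rule that)
  define S where "S = (SUP (x, i)\<in>UNIV. emeasure (\<pi> i x) (- ball 0 1))"
  obtain c where c: "\<And>x. (SUP i. \<integral>\<^sup>+ z\<in>ball 0 1. ennreal ((norm z)\<^sup>2) \<partial>\<pi> i x)
      \<le> ennreal (c * (1 + (norm x)\<^sup>2))" "0 < c"
    using small_jumps by (elim exE conjE) (rule that, simp_all)
  define W where "W = ennreal K * S + ennreal K * ennreal (c * (1 + (\<rho> + 1)\<^sup>2))"
  have W: "W < \<infinity>"
    using big_jumps by (simp add: W_def S_def ennreal_mult_less_top)
  show ?thesis
  proof
    fix x
    have [measurable_cong]: "sets (\<pi> i x) = sets borel" using levy by (simp add: levy_measure_def)
    have [measurable]: "ball (0 :: real^'n) 1 \<in> sets borel" by simp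
    \<comment> \<open>The factor \<open>e\<close> switches the small jumps off where
      \<open>f\<close> vanishes on the whole unit ball around \<open>x\<close>.\<close>
    define e :: ennreal where "e = (if norm x \<le> \<rho> + 1 then 1 else 0)"
    let ?w = "\<lambda>z :: real^'n. ennreal ((norm z)\<^sup>2) * indicator (ball 0 1) z"
    have m: "(\<lambda>z. ennreal K * indicator (- ball 0 1) z) \<in> borel_measurable (\<pi> i x)"
      "(\<lambda>z. e * ?w z) \<in> borel_measurable (\<pi> i x)"
      "(\<lambda>z. ennreal K * (e * ?w z)) \<in> borel_measurable (\<pi> i x)"
      by measurable
    let ?I = "\<integral>\<^sup>+ z. e * ?w z \<partial>\<pi> i x"
    have "ennreal (norm (LINT z|\<pi> i x. jump_integrand f x i z)) \<le>
        (\<integral>\<^sup>+ z. norm (jump_integrand f x i z) \<partial>\<pi> i x)"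
      using generator_defined_C2b[of f i, OF f] unfolding generator_defined_def
      by (rule integral_norm_bound_ennreal)
    also have "\<dots> \<le> (\<integral>\<^sup>+ z. ennreal K * indicator (- ball 0 1) z +
        ennreal K * (e * ?w z) \<partial>\<pi> i x)"
    proof (rule nn_integral_mono)
      fix z :: "real^'n"
      consider "1 \<le> norm z" | "norm z < 1" "norm x \<le> \<rho> + 1" | "norm z < 1" "\<rho> + 1 < norm x"
        by linarith
      then show "ennreal (norm (jump_integrand f x i z)) \<le> ennreal K * indicator (- ball 0 1) z +
          ennreal K * (e * ?w z)"
      proof cases
        case 1
        then have "\<bar>jump_integrand f x i z\<bar> \<le> K"
          using K(2)[of x z] one_le_power[of "norm z" 2] by simp
        then have "ennreal (norm (jump_integrand f x i z)) \<le> ennreal K" by (simp add: ennreal_leI)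
        then show ?thesis using 1 by (simp add: add_increasing2)
      next
        case 2
        then have "\<bar>jump_integrand f x i z\<bar> \<le> K * (norm z)\<^sup>2"
          using K(2)[of x z] power_le_one[of "norm z" 2] by (simp add: min_def split: if_splits)
        then have "ennreal (norm (jump_integrand f x i z)) \<le> ennreal (K * (norm z)\<^sup>2)"
          by (simp add: ennreal_leI)
        also have "\<dots> = ennreal K * ennreal ((norm z)\<^sup>2)" using K(1) by (simp add: ennreal_mult)
        finally show ?thesis using 2 by (simp add: e_def)
      next
        case 3
        have "\<rho> < norm (x + z)" using 3 norm_triangle_ineq2[of x "- z"] by simp
        moreover have "gradient (\<lambda>y. f y i) x = gradient (\<lambda>y. 0) x"
          by (rule gradient_cong_open[of "- cball 0 \<rho>"]) (use 3 supp in \<open>auto simp: open_Compl\<close>)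
        ultimately have "jump_integrand f x i z = 0"
          using supp 3 by (simp add: jump_integrand_def gradient_def partial_const inner_vec_def)
        then show ?thesis by simp
      qed
    qed
    also have "\<dots> = (\<integral>\<^sup>+ z. ennreal K * indicator (- ball 0 1) z \<partial>\<pi> i x) + ennreal K * ?I"
      by (simp only: nn_integral_add[OF m(1,3)] nn_integral_cmult[OF m(2)])
    also have "\<dots> \<le> W"
    proof -
      have "(\<integral>\<^sup>+ z. ennreal K * indicator (- ball 0 1) z \<partial>\<pi> i x) =
          ennreal K * emeasure (\<pi> i x) (- ball 0 1)"
        by (rule nn_integral_cmult_indicator) measurable
      moreover have "emeasure (\<pi> i x) (- ball 0 1) \<le> S"
        unfolding S_def by (rule SUP_upper2[of "(x, i)"]) simp_all
      moreover have "?I \<le> ennreal (c * (1 + (\<rho> + 1)\<^sup>2))"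
      proof (cases "norm x \<le> \<rho> + 1")
        case True
        have "?I \<le> (SUP i. \<integral>\<^sup>+ z\<in>ball 0 1. ennreal ((norm z)\<^sup>2) \<partial>\<pi> i x)"
          using True by (simp add: e_def) (rule SUP_upper, simp)
        also note c(1)
        also have "ennreal (c * (1 + (norm x)\<^sup>2)) \<le> ennreal (c * (1 + (\<rho> + 1)\<^sup>2))"
          using c(2) True by (intro ennreal_leI mult_left_mono add_left_mono power_mono) auto
        finally show ?thesis .
      qed (simp add: e_def)
      ultimately show ?thesis unfolding W_def
        by (simp only:) (intro add_mono mult_left_mono; simp)
    qed
    finally have "\<bar>LINT z|\<pi> i x. jump_integrand f x i z\<bar> \<le> enn2real W"
      using enn2real_mono[of _ W] W by fastforce
    then show "(LINT z|\<pi> i x. jump_integrand f x i z) \<le> enn2real W" by linarith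
  qed
qed

lemma diffusion_matrix_continuous: "continuous_on UNIV (\<lambda>x. diffusion_matrix \<sigma> x i $ k $ l)"
proof -
  note \<sigma> = continuous_on_component[OF continuous_on_component[OF sigma_cont]]
  show ?thesis
    unfolding diffusion_matrix_def matrix_matrix_mult_def transpose_def
    by (simp, intro continuous_on_sum continuous_on_mult \<sigma>)
qed

lemma generator_bounded_above:
  assumes C2: "\<And>j. C2 (\<lambda>y. f y j)" and supp: "\<And>y j. \<rho> < norm y \<Longrightarrow> f y j = 0"
  obtains C where "0 \<le> C" "\<And>x i. generator \<sigma> b \<pi> Q f x i \<le> C"
proof -
  have 0: "f y j = 0" if "y \<notin> cball 0 \<rho>" for y j using that supp by auto
  have C2b: "C2b (\<lambda>y. f y j)" for j
    by (rule C2b_compact_support[OF C2 compact_cball 0])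
  have "\<exists>C. \<forall>x. generator \<sigma> b \<pi> Q f x i \<le> C" for i
  proof -
    note p = partial_outside_support[OF compact_cball 0]
    have "bounded (range (\<lambda>x. \<Sum>k\<in>UNIV. \<Sum>l\<in>UNIV.
        diffusion_matrix \<sigma> x i $ k $ l * partial k (partial l (\<lambda>y. f y i)) x))"
      by (intro bounded_range_compact_support[OF _ compact_cball[of 0 \<rho>]]
          continuous_on_sum continuous_on_mult diffusion_matrix_continuous partial_continuous_on C2_partial C2)
        (simp add: partial_outside_support[OF compact_cball p] del: mem_cball_0 mem_cball)
    then obtain K1 where K1: "\<And>x. \<bar>\<Sum>k\<in>UNIV. \<Sum>l\<in>UNIV.
        diffusion_matrix \<sigma> x i $ k $ l * partial k (partial l (\<lambda>y. f y i)) x\<bar> \<le> K1"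
      unfolding bounded_iff by auto
    have "bounded (range (\<lambda>x. \<Sum>k\<in>UNIV. b x i $ k * partial k (\<lambda>y. f y i) x))"
      by (intro bounded_range_compact_support[OF _ compact_cball[of 0 \<rho>]]
          continuous_on_sum continuous_on_mult continuous_on_component[OF b_cont]
          partial_continuous_on C2_imp_C1 C2)
        (simp add: p del: mem_cball_0 mem_cball)
    then obtain K2 where K2: "\<And>x. \<bar>\<Sum>k\<in>UNIV. b x i $ k * partial k (\<lambda>y. f y i) x\<bar> \<le> K2"
      unfolding bounded_iff by auto
    obtain K3 where K3: "\<And>x. (LINT z|\<pi> i x. jump_integrand f x i z) \<le> K3"
      by (rule jump_integral_bounded[of f i \<rho>, OF C2b]) (erule supp, rule that)
    obtain q where q: "\<And>j x. \<bar>Q x $ i $ j\<bar> \<le> q j"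
    proof -
      have "\<exists>q. \<forall>x. \<bar>Q x $ i $ j\<bar> \<le> q" for j using Q_bounded[of i j] unfolding bounded_iff by auto
      then show ?thesis using that by metis
    qed
    obtain F where F: "\<And>j x. \<bar>f x j\<bar> \<le> F j"
    proof -
      have "\<exists>F. \<forall>x. \<bar>f x j\<bar> \<le> F" for j using C2b[of j] unfolding C2b_def bounded_iff by auto
      then show ?thesis using that by metis
    qed
    have K4: "(\<Sum>j\<in>UNIV. Q x $ i $ j * f x j) \<le> (\<Sum>j\<in>UNIV. q j * F j)" for x
    proof (rule sum_mono)
      fix j
      have "\<bar>Q x $ i $ j\<bar> * \<bar>f x j\<bar> \<le> q j * F j"
        by (intro mult_mono' q F) auto
      then show "Q x $ i $ j * f x j \<le> q j * F j"
        by (simp flip: abs_mult)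
    qed
    have "generator \<sigma> b \<pi> Q f x i \<le> 1/2 * K1 + K2 + K3 + (\<Sum>j\<in>UNIV. q j * F j)" for x
      unfolding generator_def
      by (intro add_mono mult_left_mono K3 K4 abs_le_D1[OF K1] abs_le_D1[OF K2]) simp
    then show ?thesis by blast
  qed
  then obtain C where C: "\<And>i x. generator \<sigma> b \<pi> Q f x i \<le> C i" by metis
  show ?thesis
  proof
    show "0 \<le> (\<Sum>i\<in>UNIV. \<bar>C i\<bar>)" by (simp add: sum_nonneg)
    show "generator \<sigma> b \<pi> Q f x i \<le> (\<Sum>i\<in>UNIV. \<bar>C i\<bar>)" for x i
      using C[of x i] member_le_sum[of i UNIV "\<lambda>i. \<bar>C i\<bar>"] by fastforce
  qed
qed

end

section \<open>Paths and hitting times\<close>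

lemma space_skorohod: "\<omega> \<in> space skorohod_space \<Longrightarrow> cadlag \<omega>"
  by (simp add: skorohod_space_def space_restrict_space)

lemma cadlag_locally_bounded:
  assumes \<omega>: "cadlag \<omega>" and t: "0 \<le> t"
  shows "\<exists>e>0. \<exists>B. \<forall>s\<ge>0. \<bar>s - t\<bar> < e \<longrightarrow> norm (fst (\<omega> s)) \<le> B"
proof -
  have bdd: "\<exists>B. \<forall>\<^sub>F s in F. norm (g s) \<le> B" if "(g \<longlongrightarrow> y) F" for g :: "real \<Rightarrow> real^'n" and y F
  proof -
    have "\<forall>\<^sub>F s in F. norm (g s) < norm y + 1"
      by (rule order_tendstoD(2)[OF tendsto_norm[OF that]]) simp
    then show ?thesis by (auto elim!: eventually_mono intro!: exI[of _ "norm y + 1"])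
  qed
  obtain B1 where "\<forall>\<^sub>F s in at_right t. norm (fst (\<omega> s)) \<le> B1"
    using bdd \<omega> t unfolding cadlag_def by blast
  then obtain u where u: "t < u" "\<And>s. t < s \<Longrightarrow> s < u \<Longrightarrow> norm (fst (\<omega> s)) \<le> B1"
    unfolding eventually_at_right_field by blast
  obtain l B2 where l: "l < t" "\<And>s. 0 \<le> s \<Longrightarrow> l < s \<Longrightarrow> s < t \<Longrightarrow> norm (fst (\<omega> s)) \<le> B2"
  proof (cases "t = 0")
    case True
    \<comment> \<open>At time 0 there is no earlier time to control, so any negative
      \<open>l\<close> and any \<open>B2\<close> will do.\<close>
    show ?thesis by (rule that[of "-1"]) (use True in auto)
  next
    case False
    then obtain B2 where "\<forall>\<^sub>F s in at_left t. norm (fst (\<omega> s)) \<le> B2"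
      using bdd \<omega> t unfolding cadlag_def by (metis less_eq_real_def)
    then show ?thesis using that unfolding eventually_at_left_field by blast
  qed
  show ?thesis
  proof (intro exI conjI allI impI)
    show "0 < min (u - t) (t - l)" using u l by simp
    fix s assume "0 \<le> s" "\<bar>s - t\<bar> < min (u - t) (t - l)"
    then show "norm (fst (\<omega> s)) \<le> max (norm (fst (\<omega> t))) (max B1 B2)"
      using u(2)[of s] l(2)[of s] by (cases "s = t"; cases "s < t") (auto simp: max_def)
  qed
qed

text \<open>This is where non-explosion enters: it is built into the path space.\<close>

lemma cadlag_bounded:
  assumes "cadlag \<omega>"
  obtains B where "\<And>s. 0 \<le> s \<Longrightarrow> s \<le> T \<Longrightarrow> norm (fst (\<omega> s)) \<le> B"
proof -
  have "\<forall>t. \<exists>e B. 0 \<le> t \<longrightarrow>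
      0 < e \<and> (\<forall>s\<ge>0. \<bar>s - t\<bar> < e \<longrightarrow> norm (fst (\<omega> s)) \<le> B)"
    using cadlag_locally_bounded[OF assms] by blast
  then obtain e B where eB: "\<forall>t\<ge>0.
      0 < e t \<and> (\<forall>s\<ge>0. \<bar>s - t\<bar> < e t \<longrightarrow> norm (fst (\<omega> s)) \<le> B t)"
    unfolding choice_iff by (elim exE) (rule that)
  have "{0..T} \<subseteq> (\<Union>t\<in>{0..T}. ball t (e t))"
    using eB by (intro subsetI UN_I) auto
  then obtain F where F: "F \<subseteq> {0..T}" "finite F" "{0..T} \<subseteq> (\<Union>t\<in>F. ball t (e t))"
    by (rule compactE_image[OF compact_Icc, rotated]) (rule that, assumption+, rule open_ball)
  show ?thesis
  proof (rule that)
    fix s assume s: "0 \<le> s" "s \<le> T"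
    then have "s \<in> (\<Union>t\<in>F. ball t (e t))" using F(3) by (simp add: subset_iff)
    then obtain t where t: "t \<in> F" "s \<in> ball t (e t)" by blast
    then have "0 \<le> t" "\<bar>s - t\<bar> < e t"
      using F(1) by (auto simp: dist_real_def abs_minus_commute)
    then have "norm (fst (\<omega> s)) \<le> B t" using eB s by blast
    also have "\<dots> \<le> (\<Sum>t\<in>F. \<bar>B t\<bar>)"
      by (rule order_trans[OF abs_ge_self member_le_sum[OF t(1)]]) (simp_all add: F(2))
    finally show "norm (fst (\<omega> s)) \<le> (\<Sum>t\<in>F. \<bar>B t\<bar>)" .
  qed
qed

text \<open>The inequality \<open>s < t\<close> has to be strict, since a visit exactly at
  \<open>t\<close> is compatible with an infimum equal to \<open>t\<close>. Paths that never visit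
  \<open>U\<close> are covered because the infimum of the empty set is infinity.\<close>

lemma le_hitting_time_iff:
  "ennreal t \<le> hitting_time U \<omega> \<longleftrightarrow> (\<forall>s. 0 \<le> s \<and> s < t \<longrightarrow> \<omega> s \<notin> U)"
  by (auto simp: hitting_time_def le_INF_iff not_le dest: leD)

text \<open>By right continuity a visit to the open set \<open>G\<close> at time \<open>s\<close>
  lasts on some interval to the right of \<open>s\<close>, and as \<open>s < t\<close> this interval
  contains a rational before \<open>t\<close>. Uncountably many conditions thus reduce to countably
  many.\<close>

lemma le_hitting_time_rat_iff:
  assumes "cadlag \<omega>" "open G"
  shows "ennreal t \<le> hitting_time (G \<times> UNIV) \<omega> \<longleftrightarrow>
    (\<forall>q\<in>\<rat>. 0 \<le> q \<and> q < t \<longrightarrow> fst (\<omega> q) \<notin> G)"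
proof -
  have "\<exists>q\<in>\<rat>. 0 \<le> q \<and> q < t \<and> fst (\<omega> q) \<in> G"
    if s: "0 \<le> s" "s < t" "fst (\<omega> s) \<in> G" for s
  proof -
    have "((\<lambda>r. fst (\<omega> r)) \<longlongrightarrow> fst (\<omega> s)) (at_right s)"
      using assms(1) s(1) by (simp add: cadlag_def)
    then have "\<forall>\<^sub>F r in at_right s. fst (\<omega> r) \<in> G"
      using assms(2) s(3) by (rule topological_tendstoD)
    then obtain u where u: "s < u" "\<And>r. s < r \<Longrightarrow> r < u \<Longrightarrow> fst (\<omega> r) \<in> G"
      unfolding eventually_at_right_field by blast
    obtain q where "q \<in> \<rat>" "s < q" "q < min u t"
      using Rats_dense_in_real[of s "min u t"] u(1) s(2) by auto
    then show ?thesis using u(2) s(1) by (intro bexI[of _ q]) auto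
  qed
  then show ?thesis
    unfolding le_hitting_time_iff by (auto simp: mem_Times_iff)
qed

section \<open>Measurability of hitting times with respect to the path filtration\<close>

lemma space_path_filtration: "space (path_filtration t) = space skorohod_space"
  by (simp add: path_filtration_def)

lemma measurable_path_filtration_eval:
  assumes "0 \<le> s" "s \<le> t"
  shows "(\<lambda>\<omega>. \<omega> s) \<in> path_filtration t \<rightarrow>\<^sub>M state_space"
proof -
  have "(\<lambda>\<omega>. restrict \<omega> {0..t}) \<in> path_filtration t \<rightarrow>\<^sub>M PiM {0..t} (\<lambda>_. state_space)"
    unfolding path_filtration_def
    by (rule measurable_vimage_algebra1) (auto simp: skorohod_space_def space_restrict_space space_PiM)
  from measurable_compose[OF this measurable_component_singleton[of s]]
  show ?thesis using assms by simp
qed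

lemma sets_path_filtration_subset: "sets (path_filtration t) \<subseteq> sets skorohod_space"
proof -
  have "(\<lambda>\<omega>. restrict \<omega> {0..t}) \<in> PiM {0..} (\<lambda>_. state_space) \<rightarrow>\<^sub>M PiM {0..t} (\<lambda>_. state_space)"
    by (rule measurable_restrict_subset) auto
  then have "(\<lambda>\<omega>. restrict \<omega> {0..t}) \<in> skorohod_space \<rightarrow>\<^sub>M PiM {0..t} (\<lambda>_. state_space)"
    unfolding skorohod_space_def by (rule measurable_restrict_space1)
  then show ?thesis
    unfolding path_filtration_def by (intro sets_image_in_sets refl)
qed

text \<open>Only coordinates at rational times before \<open>t\<close> are involved, so the event
  lies in the raw filtration at \<open>t\<close>. The event that the hitting time is at most
  \<open>t\<close> would in general require a look beyond \<open>t\<close>; this is why the grid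
  sampling tests whether \<open>t\<close> is at most the hitting time.\<close>

lemma le_hitting_time_sets:
  fixes G :: "(real^'n::finite) set"
  assumes "open G"
  shows "{\<omega> :: real \<Rightarrow> (real^'n) \<times> 'm::finite. \<omega> \<in> space skorohod_space \<and>
    ennreal t \<le> hitting_time (G \<times> UNIV) \<omega>} \<in> sets (path_filtration t)"
proof -
  let ?F = "path_filtration t :: (real \<Rightarrow> (real^'n) \<times> 'm) measure"
  let ?R = "{q \<in> \<rat>. 0 \<le> q \<and> q < t}"
  have "countable ?R" using countable_rat by (rule countable_subset[rotated]) auto
  have "{\<omega> \<in> space ?F. \<forall>q\<in>?R. fst (\<omega> q) \<notin> G} \<in> sets ?F"
  proof (rule sets.sets_Collect_countable_All'[OF _ \<open>countable ?R\<close>])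
    fix q assume q: "q \<in> ?R"
    then have [measurable]: "(\<lambda>\<omega>. \<omega> q) \<in> ?F \<rightarrow>\<^sub>M borel \<Otimes>\<^sub>M count_space UNIV"
      using measurable_path_filtration_eval[of q t] by (simp add: state_space_def)
    have [measurable]: "G \<in> sets borel" using assms by simp
    show "{\<omega> \<in> space ?F. fst (\<omega> q) \<notin> G} \<in> sets ?F" by measurable
  qed
  moreover have "{\<omega> \<in> space skorohod_space. ennreal t \<le> hitting_time (G \<times> UNIV) \<omega>} =
      {\<omega> \<in> space ?F. \<forall>q\<in>?R. fst (\<omega> q) \<notin> G}"
    using le_hitting_time_rat_iff[OF space_skorohod assms] by (auto simp: space_path_filtration)
  ultimately show ?thesis by simp
qed

lemma hitting_time_measurable:
  fixes G :: "(real^'n::finite) set"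
  assumes "open G"
  shows "hitting_time (G \<times> (UNIV :: 'm::finite set)) \<in> borel_measurable skorohod_space"
proof (rule borel_measurableI_ge)
  fix c :: ennreal
  have *: "{\<omega> \<in> space skorohod_space. ennreal t \<le> hitting_time (G \<times> (UNIV :: 'm set)) \<omega>} \<in> sets skorohod_space" for t
    using le_hitting_time_sets[OF assms] sets_path_filtration_subset by blast
  show "{\<omega> \<in> space skorohod_space. c \<le> hitting_time (G \<times> (UNIV :: 'm set)) \<omega>} \<in> sets skorohod_space"
  proof (cases c)
    case (real r)
    then show ?thesis using *[of r] by simp
  next
    case top
    \<comment> \<open>The level infinity is not of the form \<open>ennreal t\<close>; it is
      approached through the natural numbers.\<close>
    have top_iff: "top \<le> u \<longleftrightarrow> (\<forall>n. ennreal (real n) \<le> u)" for u :: ennreal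
    proof
      assume le: "\<forall>n. ennreal (real n) \<le> u"
      show "top \<le> u"
      proof (rule ccontr)
        assume "\<not> top \<le> u"
        then obtain n where "u < of_nat n" using ennreal_Ex_less_of_nat[of u] by (auto simp: not_le)
        with le show False by (simp add: not_le[symmetric] ennreal_of_nat_eq_real_of_nat)
      qed
    qed (auto intro: order_trans[OF top_greatest])
    have "{\<omega> \<in> space skorohod_space. c \<le> hitting_time (G \<times> (UNIV :: 'm set)) \<omega>} =
        {\<omega> \<in> space skorohod_space. \<forall>n. ennreal (real n) \<le> hitting_time (G \<times> (UNIV :: 'm set)) \<omega>}"
      unfolding top top_iff by simp
    also have "\<dots> \<in> sets skorohod_space" by (rule sets.sets_Collect_countable_All) (rule *)
    finally show ?thesis .
  qed
qed

section \<open>Expected hitting times from the martingale problem\<close>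

text \<open>As \<open>A\<close> holds on an initial segment, the sum telescopes to
  \<open>y k - y 0\<close>, where \<open>k\<close> is the first index at which \<open>A\<close>
  fails, or \<open>N\<close> if that comes earlier; nonnegativity lets \<open>y k\<close> be
  dropped.\<close>

lemma grid_sum_lower:
  fixes y :: "nat \<Rightarrow> real"
  assumes "\<And>j. A (Suc j) \<Longrightarrow> A j" and "\<And>j. 0 \<le> y j"
  shows "- y 0 \<le> (\<Sum>j<N. of_bool (A j) * (y (Suc j) - y j))"
proof -
  let ?S = "\<lambda>N. \<Sum>j<N. of_bool (A j) * (y (Suc j) - y j)"
  have "(A N \<longrightarrow> ?S N = y N - y 0) \<and> - y 0 \<le> ?S N"
  proof (induction N)
    case 0
    show ?case using assms(2)[of 0] by simp
  next
    case (Suc N)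
    then show ?case using assms(1)[of N] assms(2)[of "Suc N"] by (cases "A N") auto
  qed
  then show ?thesis by blast
qed

text \<open>If \<open>A\<close> first fails at some positive \<open>j\<close> up to
  \<open>N\<close>, the first \<open>j - 1\<close> cells contribute at most \<open>- h\<close> each
  and the last one at most \<open>C * h\<close>, in total \<open>(C + 1) * h - j * h\<close>, and
  \<open>m\<close> is at most \<open>j * h\<close>. If \<open>A\<close> still holds at
  \<open>N\<close>, the sum is at most \<open>- (N * h)\<close>, and \<open>m\<close> is at most
  \<open>N * h\<close>.\<close>

lemma grid_sum_upper:
  fixes d :: "nat \<Rightarrow> real"
  assumes dec: "\<And>j. A (Suc j) \<Longrightarrow> A j" and "0 \<le> C" "0 \<le> h"
    and d: "\<And>j. A j \<Longrightarrow> d j \<le> C * h" "\<And>j. A (Suc j) \<Longrightarrow> d j \<le> - h"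
    and m: "m \<le> N * h" "\<And>j. \<not> A j \<Longrightarrow> m \<le> j * h"
  shows "(\<Sum>j<N. of_bool (A j) * d j) \<le> (C + 1) * h - m"
proof -
  let ?S = "\<lambda>N. \<Sum>j<N. of_bool (A j) * d j"
  have mono: "A k \<Longrightarrow> j \<le> k \<Longrightarrow> A j" for j k
    by (induction k) (use dec in \<open>auto simp: le_Suc_eq\<close>)
  have "(A N \<and> ?S N \<le> - (N * h)) \<or> (\<exists>j\<le>N. \<not> A j \<and> ?S N \<le> (C + 1) * h - j * h)"
  proof (induction N)
    case 0
    show ?case using assms(2,3) by simp
  next
    case (Suc N)
    then show ?case
    proof (elim disjE exE conjE)
      assume "A N" "?S N \<le> - (N * h)"
      then show ?thesis using d[of N]
        by (cases "A (Suc N)") (auto simp: algebra_simps intro!: exI[of _ "Suc N"])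
    next
      fix j assume j: "j \<le> N" "\<not> A j" "?S N \<le> (C + 1) * h - j * h"
      then have "\<not> A N" using mono by blast
      then show ?thesis using j by (intro disjI2 exI[of _ j]) auto
    qed
  qed
  then show ?thesis
  proof (elim disjE exE conjE)
    assume "?S N \<le> - (N * h)"
    moreover have "0 \<le> (C + 1) * h" using assms(2,3) by simp
    ultimately show ?thesis using m(1) by linarith
  next
    fix j assume "\<not> A j" "?S N \<le> (C + 1) * h - j * h"
    then show ?thesis using m(2)[of j] by linarith
  qed
qed

text \<open>The bound on \<open>g\<close> is asked for only on the open interval, because at its
  right end the path may already have entered the target set; a single point is Lebesgue
  null.\<close>

lemma set_integral_increment_le:
  fixes g :: "real \<Rightarrow> real"
  assumes g: "set_integrable lborel {0..t} g" and st: "0 \<le> s" "s \<le> t"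
    and le: "\<And>u. s < u \<Longrightarrow> u < t \<Longrightarrow> g u \<le> c"
  shows "(LINT u:{0..t}|lborel. g u) - (LINT u:{0..s}|lborel. g u) \<le> c * (t - s)"
proof -
  have un: "{0..t} = {0..s} \<union> {s<..t}" using st by auto
  have i: "set_integrable lborel {0..s} g" "set_integrable lborel {s<..t} g"
    using st by (auto intro!: set_integrable_subset[OF g])
  have "(LINT u:{0..t}|lborel. g u) - (LINT u:{0..s}|lborel. g u) = (LINT u:{s<..t}|lborel. g u)"
    unfolding un using i by (subst set_integral_Un) auto
  also have "\<dots> \<le> (LINT u:{s<..t}|lborel. c)"
  proof (rule set_integral_mono_AE[OF i(2)])
    show "set_integrable lborel {s<..t} (\<lambda>u. c)"
      using st by (simp add: set_integrable_def)
    show "AE u \<in> {s<..t} in lborel. g u \<le> c"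
      using AE_lborel_singleton[of t] by eventually_elim (use le in auto)
  qed
  also have "\<dots> = c * (t - s)"
    using st by (simp add: set_lebesgue_integral_def)
  finally show ?thesis .
qed

text \<open>Increments are orthogonal to events of the past. Together with integrability of
  \<open>M\<close>, this is all that the hitting time estimate takes from the martingale
  property.\<close>

lemma martingale_increment_integral:
  assumes "prob_space P" "martingale P F M" "subalgebra P (F s)" "0 \<le> s" "s \<le> t"
    and A: "A \<in> sets (F s)"
  shows "(\<integral>\<omega>. indicator A \<omega> * (M t \<omega> - M s \<omega>) \<partial>P) = 0"
proof -
  interpret prob_space P by fact
  interpret finite_measure_subalgebra P "F s"
    by unfold_locales fact
  have M: "integrable P (M t)" "integrable P (M s)"
    and e: "AE \<omega> in P. real_cond_exp P (F s) (M t) \<omega> = M s \<omega>"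
    using assms by (auto simp: martingale_def)
  have AP: "A \<in> sets P" using A assms(3) by (auto simp: subalgebra_def)
  have "(\<integral>\<omega>\<in>A. M t \<omega> \<partial>P) = (\<integral>\<omega>\<in>A. real_cond_exp P (F s) (M t) \<omega> \<partial>P)"
    by (rule real_cond_exp_intA[OF M(1) A])
  also have "\<dots> = (\<integral>\<omega>\<in>A. M s \<omega> \<partial>P)"
    unfolding set_lebesgue_integral_def
    by (rule integral_cong_AE) (use M AP e in auto)
  finally show ?thesis
    using integrable_mult_indicator[OF AP M(1)] integrable_mult_indicator[OF AP M(2)]
    by (simp add: set_lebesgue_integral_def right_diff_distrib)
qed

text \<open>Optional stopping is replaced by sampling on a grid of mesh \<open>h\<close>: the event that the set has
  not been entered before \<open>j * h\<close> belongs to the sigma-algebra at \<open>j * h\<close>, and overshooting the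
  hitting time by at most \<open>h\<close> costs at most \<open>(C + 1) * h\<close>.\<close>

lemma expected_hitting_time_le:
  fixes f :: "real^'n::finite \<Rightarrow> 'm::finite \<Rightarrow> real"
  assumes law: "solves_martingale_problem \<sigma> b \<pi> Q x i P"
    and C2b: "\<And>j. C2b (\<lambda>y. f y j)" and f0: "\<And>y j. 0 \<le> f y j"
    and G: "open G" and drift: "\<And>y j. y \<notin> G \<Longrightarrow> generator \<sigma> b \<pi> Q f y j \<le> -1"
    and C: "0 \<le> C" "\<And>y j. generator \<sigma> b \<pi> Q f y j \<le> C"
  shows "(\<integral>\<^sup>+ \<omega>. min (hitting_time (G \<times> UNIV) \<omega>) (ennreal (real n)) \<partial>P) \<le> ennreal (f x i)"
proof -
  interpret prob_space P using law by (simp add: solves_martingale_problem_def)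
  have sets_P: "sets P = sets skorohod_space" using law by (simp add: solves_martingale_problem_def)
  then have space_P: "space P = space skorohod_space" by (rule sets_eq_imp_space_eq)
  define H where "H = hitting_time (G \<times> (UNIV :: 'm set))"
  define g where "g \<omega> s = (case \<omega> s of (y, j) \<Rightarrow> generator \<sigma> b \<pi> Q f y j)" for \<omega> and s :: real
  define I where "I t \<omega> = (LINT s:{0..t}|lborel. g \<omega> s)" for t \<omega>
  define M where "M t \<omega> = case_prod f (\<omega> t) - case_prod f (\<omega> 0) - I t \<omega>" for t \<omega>
  note law' = conjunct2[OF conjunct2[OF law[unfolded solves_martingale_problem_def]]]
  have "(AE \<omega> in P. \<forall>t\<ge>0. set_integrable lborel {0..t} (g \<omega>)) \<and> martingale P path_filtration M"
    unfolding g_def[abs_def] I_def[abs_def] M_def[abs_def]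
    by (rule mp[OF spec[OF conjunct2[OF law'], of f]]) (intro allI C2b)
  then have int: "AE \<omega> in P. \<forall>t\<ge>0. set_integrable lborel {0..t} (g \<omega>)"
    and mart: "martingale P path_filtration M"
    by blast+
  have start: "AE \<omega> in P. \<omega> 0 = (x, i)" using AE_prob_1[OF conjunct1[OF law']] by simp
  have sub: "subalgebra P (path_filtration t)" for t
    using sets_path_filtration_subset by (simp add: subalgebra_def space_path_filtration space_P sets_P)
  have [measurable]: "H \<in> borel_measurable P"
    using hitting_time_measurable[OF G] by (simp add: H_def sets_P cong: measurable_cong_sets)
  \<comment> \<open>The truncation at \<open>n\<close> precedes \<open>enn2real\<close>, which sends
    infinity to 0 and would count paths that never hit as hitting at time 0.\<close>
  define \<tau> where "\<tau> \<omega> = enn2real (min (H \<omega>) (ennreal (real n)))" for \<omega>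
  have \<tau>: "ennreal (\<tau> \<omega>) = min (H \<omega>) (ennreal (real n))" for \<omega>
    unfolding \<tau>_def by (rule ennreal_enn2real) (simp add: min_less_iff_disj)
  have \<tau>_bounds: "0 \<le> \<tau> \<omega>" "\<tau> \<omega> \<le> real n" for \<omega>
  proof -
    show "0 \<le> \<tau> \<omega>" by (simp add: \<tau>_def)
    have "ennreal (\<tau> \<omega>) \<le> ennreal (real n)" unfolding \<tau> by simp
    then show "\<tau> \<omega> \<le> real n" by simp
  qed
  have \<tau>_int: "integrable P \<tau>"
    by (rule integrable_const_bound[of _ "real n"]) (use \<tau>_bounds in simp, simp add: \<tau>_def[abs_def])
  have bound: "expectation \<tau> \<le> f x i + (C + 1) * (real n / real (Suc N))" for N
  proof -
    \<comment> \<open>The \<open>Suc N\<close> cells of length \<open>h\<close> exactly fill the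
      time interval from 0 to \<open>n\<close>; \<open>Suc\<close> keeps the divisor
      positive.\<close>
    define h where "h = real n / real (Suc N)"
    have h: "0 \<le> h" by (simp add: h_def)
    define t where "t j = real j * h" for j
    have t: "0 \<le> t j" "t j \<le> t (Suc j)" "t (Suc j) - t j = h" for j
      using h by (auto simp: t_def algebra_simps)
    define A where "A j = {\<omega> \<in> space P. ennreal (t j) \<le> H \<omega>}" for j
    have A: "A j \<in> sets (path_filtration (t j))" for j
      unfolding A_def H_def space_P by (rule le_hitting_time_sets[OF G])
    then have A_P: "A j \<in> sets P" for j using sub by (auto simp: subalgebra_def)
    have M_int: "integrable P (M (t j))" for j
      using mart t by (simp add: martingale_def)
    have incr_int: "integrable P (\<lambda>\<omega>. indicator (A j) \<omega> * (M (t (Suc j)) \<omega> - M (t j) \<omega>))" for j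
      using integrable_mult_indicator[OF A_P Bochner_Integration.integrable_diff[OF M_int M_int]]
      by simp
    \<comment> \<open>This is the martingale increment along the grid up to the first grid time
      strictly after \<open>H\<close>, or up to \<open>n\<close>. Each indicator is known at the
      left end of its cell, so the expectation is 0; a pathwise lower bound for \<open>?Z\<close>
      then bounds the expectation of \<open>\<tau>\<close>.\<close>
    let ?Z = "\<lambda>\<omega>. \<Sum>j<Suc N. indicator (A j) \<omega> * (M (t (Suc j)) \<omega> - M (t j) \<omega>)"
    have "AE \<omega> in P. \<tau> \<omega> - f x i - (C + 1) * h \<le> ?Z \<omega>"
      using start int AE_space
    proof eventually_elim
      case (elim \<omega>)
      define B where "B j \<longleftrightarrow> ennreal (t j) \<le> H \<omega>" for j
      have B: "indicator (A j) \<omega> = of_bool (B j)" for j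
        using elim by (simp add: A_def B_def indicator_def)
      have dec: "B (Suc j) \<Longrightarrow> B j" for j
        unfolding B_def using t(2)[of j] ennreal_leI order_trans by blast
      have gC: "g \<omega> u \<le> C" for u using C by (simp add: g_def split: prod.split)
      have g1: "g \<omega> u \<le> -1" if "0 \<le> u" "u < t j" "B j" for u j
        using that drift unfolding B_def H_def le_hitting_time_iff g_def
        by (auto simp: mem_Times_iff split: prod.split)
      have d: "I (t (Suc j)) \<omega> - I (t j) \<omega> \<le> c * h"
        if "\<And>u. t j < u \<Longrightarrow> u < t (Suc j) \<Longrightarrow> g \<omega> u \<le> c" for j c
        using set_integral_increment_le[of "t (Suc j)" "g \<omega>" "t j" c] that elim t
        unfolding I_def by simp
      have "(\<Sum>j<Suc N. of_bool (B j) * (I (t (Suc j)) \<omega> - I (t j) \<omega>)) \<le> (C + 1) * h - \<tau> \<omega>"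
      proof (rule grid_sum_upper[OF dec C(1) h])
        show "I (t (Suc j)) \<omega> - I (t j) \<omega> \<le> C * h" for j
          by (rule d) (rule gC)
        show "I (t (Suc j)) \<omega> - I (t j) \<omega> \<le> - h" if "B (Suc j)" for j
          using d[of j "-1"] g1[OF _ _ that] t(1)[of j] by simp
        show "\<tau> \<omega> \<le> real (Suc N) * h" using \<tau>_bounds by (simp add: h_def)
        show "\<tau> \<omega> \<le> real j * h" if "\<not> B j" for j
        proof -
          have "ennreal (\<tau> \<omega>) \<le> ennreal (t j)"
            using that unfolding \<tau> B_def by (intro min.coboundedI1) simp
          then show ?thesis using t(1)[of j] by (simp add: t_def)
        qed
      qed
      moreover have "- case_prod f (\<omega> (t 0)) \<le>
          (\<Sum>j<Suc N. of_bool (B j) * (case_prod f (\<omega> (t (Suc j))) - case_prod f (\<omega> (t j))))"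
        by (rule grid_sum_lower[OF dec]) (use f0 in \<open>auto split: prod.split\<close>)
      moreover have "case_prod f (\<omega> (t 0)) = f x i" using elim by (simp add: t_def)
      moreover have "?Z \<omega> =
          (\<Sum>j<Suc N. of_bool (B j) * (case_prod f (\<omega> (t (Suc j))) - case_prod f (\<omega> (t j)))) -
          (\<Sum>j<Suc N. of_bool (B j) * (I (t (Suc j)) \<omega> - I (t j) \<omega>))"
        unfolding sum_subtractf[symmetric] B M_def by (rule sum.cong) (simp_all add: algebra_simps)
      ultimately show ?case by linarith
    qed
    then have "expectation (\<lambda>\<omega>. \<tau> \<omega> - f x i - (C + 1) * h) \<le> expectation ?Z"
      using \<tau>_int incr_int
      by (intro integral_mono_AE Bochner_Integration.integrable_sum Bochner_Integration.integrable_diff) auto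
    also have "expectation ?Z = 0"
      using martingale_increment_integral[OF prob_space_axioms mart sub t(1,2) A] incr_int
      by (subst Bochner_Integration.integral_sum) auto
    finally show ?thesis using \<tau>_int by (simp add: h_def prob_space)
  qed
  \<comment> \<open>\<open>C\<close> and \<open>n\<close> stay fixed while the mesh shrinks, so the
    overshoot term vanishes.\<close>
  have "expectation \<tau> \<le> f x i"
  proof (rule LIMSEQ_le_const)
    have "(\<lambda>N. f x i + (C + 1) * (real n / real (Suc N))) \<longlonglongrightarrow> f x i + (C + 1) * 0"
      by (intro tendsto_intros LIMSEQ_Suc[OF lim_const_over_n])
    then show "(\<lambda>N. f x i + (C + 1) * (real n / real (Suc N))) \<longlonglongrightarrow> f x i" by simp
    show "\<exists>N. \<forall>k\<ge>N. expectation \<tau> \<le> f x i + (C + 1) * (real n / real (Suc k))"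
      using bound by blast
  qed
  moreover have "(\<integral>\<^sup>+ \<omega>. min (H \<omega>) (ennreal (real n)) \<partial>P) = ennreal (expectation \<tau>)"
    unfolding \<tau>[symmetric] using \<tau>_int \<tau>_bounds by (intro nn_integral_eq_integral) auto
  ultimately show ?thesis by (simp add: H_def ennreal_leI)
qed

section \<open>Removal of the truncation\<close>

lemma hitting_time_le_SUP:
  assumes \<omega>: "cadlag \<omega>"
  shows "hitting_time (D \<times> UNIV) \<omega> \<le>
    (SUP n. min (hitting_time ((D \<union> - cball 0 (real n)) \<times> UNIV) \<omega>) (ennreal (real n)))"
\<comment> \<open>Levels strictly below the hitting time are finite, so only a bounded time interval
  of the path matters even if the hitting time is infinite.\<close>
proof (rule dense_le)
  fix c assume c: "c < hitting_time (D \<times> UNIV) \<omega>"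
  then have "c \<noteq> top" by (rule less_top[THEN iffD2, OF less_le_trans[OF _ top_greatest]])
  then obtain r where r: "0 \<le> r" "c = ennreal r"
    by (cases c rule: ennreal_cases) simp_all
  obtain B where B: "\<And>s. 0 \<le> s \<Longrightarrow> s \<le> r \<Longrightarrow> norm (fst (\<omega> s)) \<le> B"
    by (rule cadlag_bounded[OF \<omega>, of r]) (rule that)
  \<comment> \<open>That \<open>n\<close> is at least \<open>B\<close> keeps the path in the closed
    ball of radius \<open>n\<close> up to time \<open>r\<close>; that it is at least
    \<open>r\<close> keeps the cap at \<open>n\<close> from falling below \<open>c\<close>.\<close>
  obtain n where n: "max B r \<le> real n" using real_arch_simple ..
  have D: "\<forall>s. 0 \<le> s \<and> s < r \<longrightarrow> \<omega> s \<notin> D \<times> UNIV"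
    using less_imp_le[OF c] unfolding r(2) le_hitting_time_iff .
  have "\<omega> s \<notin> (D \<union> - cball 0 (real n)) \<times> UNIV" if "0 \<le> s" "s < r" for s
  proof -
    have "norm (fst (\<omega> s)) \<le> real n" using B[of s] n that by linarith
    then show ?thesis using D that by (simp add: mem_Times_iff)
  qed
  then have "c \<le> hitting_time ((D \<union> - cball 0 (real n)) \<times> UNIV) \<omega>"
    unfolding r(2) le_hitting_time_iff by simp
  moreover have "c \<le> ennreal (real n)" using n r by (simp add: ennreal_leI)
  ultimately show "c \<le> (SUP n. min (hitting_time ((D \<union> - cball 0 (real n)) \<times> UNIV) \<omega>) (ennreal (real n)))"
    by (intro SUP_upper2[of n] UNIV_I min.boundedI)
qed

theorem theorem3p4:
  fixes \<sigma> :: "real^'n::finite \<Rightarrow> 'm::finite \<Rightarrow> real^'n^'n"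
    and b :: "real^'n \<Rightarrow> 'm \<Rightarrow> real^'n"
    and \<pi> :: "'m \<Rightarrow> real^'n \<Rightarrow> (real^'n) measure"
    and Q :: "real^'n \<Rightarrow> real^'m^'m"
    and P :: "real^'n \<Rightarrow> 'm \<Rightarrow> (real \<Rightarrow> (real^'n) \<times> 'm) measure"
    and D :: "(real^'n) set"
  assumes coefficients: "regime_switching_coefficients \<sigma> b \<pi> Q"
    and law: "\<And>x i. solves_martingale_problem \<sigma> b \<pi> Q x i (P x i)"
    and domain: "bounded_domain D"
    and lyapunov: "\<exists>V :: real^'n \<Rightarrow> 'm \<Rightarrow> real.
      (\<forall>i. C2 (\<lambda>x. V x i) \<and> (\<forall>x. 0 \<le> V x i)) \<and>
      (\<forall>x\<in>- D. \<forall>i. generator_defined \<pi> V x i \<and> generator \<sigma> b \<pi> Q V x i \<le> -1)"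
  shows "positive_recurrent P (D \<times> UNIV)"
proof -
  interpret regime_switching_coefficients \<sigma> b \<pi> Q by fact
  obtain V :: "real^'n \<Rightarrow> 'm \<Rightarrow> real" where V: "\<And>i. C2 (\<lambda>x. V x i)" "\<And>x i. 0 \<le> V x i"
    and GV: "\<And>x i. x \<notin> D \<Longrightarrow> generator_defined \<pi> V x i"
      "\<And>x i. x \<notin> D \<Longrightarrow> generator \<sigma> b \<pi> Q V x i \<le> -1"
    using lyapunov by (elim exE conjE) (rule that, auto)
  have D: "open D" using domain by (simp add: bounded_domain_def)
  \<comment> \<open>The complement of a closed ball is open, so entering \<open>D\<close> or leaving
    the ball is the hitting of a single open set, as measurability requires.\<close>
  define G where "G n = D \<union> - cball 0 (real n)" for n
  have G: "open (G n)" for n unfolding G_def using D by (intro open_Un open_Compl) auto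
  let ?H = "hitting_time (D \<times> (UNIV :: 'm set))"
  let ?F = "\<lambda>n \<omega>. min (hitting_time (G n \<times> (UNIV :: 'm set)) \<omega>) (ennreal (real n))"
  have truncated: "(\<integral>\<^sup>+ \<omega>. ?F n \<omega> \<partial>P x i) \<le> ennreal (V x i)" for n x i
  proof -
    \<comment> \<open>With cutoff radius \<open>n + 1\<close>, the open ball of that radius is a
      neighbourhood of every point of the closed ball of radius \<open>n\<close> on which
      \<open>f\<close> and \<open>V\<close> agree, as the comparison of derivatives requires. The
      transition has width 1, hence \<open>n + 2\<close> for the support.\<close>
    obtain \<phi> :: "real^'n \<Rightarrow> real" where \<phi>: "C2 \<phi>" "\<And>x. 0 \<le> \<phi> x" "\<And>x. \<phi> x \<le> 1"
      "\<And>x. norm x \<le> real n + 1 \<Longrightarrow> \<phi> x = 1" "\<And>x. real n + 1 + 1 \<le> norm x \<Longrightarrow> \<phi> x = 0"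
      using C2_cutoff[of "real n + 1"] by auto
    define f where "f y j = V y j * \<phi> y" for y j
    have f: "C2 (\<lambda>y. f y j)" "0 \<le> f y j" "f y j \<le> V y j" for y j
      unfolding f_def using V \<phi> by (auto intro!: C2_mult mult_left_le)
    have supp: "f y j = 0" if "real n + 2 < norm y" for y j
      using that \<phi>(5)[of y] by (simp add: f_def)
    have C2b: "C2b (\<lambda>y. f y j)" for j
      by (rule C2b_compact_support[OF f(1) compact_cball[of 0 "real n + 2"]]) (simp add: supp)
    obtain C where C: "0 \<le> C" "\<And>y j. generator \<sigma> b \<pi> Q f y j \<le> C"
      by (rule generator_bounded_above[of f, OF f(1) supp]) (assumption, rule that)
    have "generator \<sigma> b \<pi> Q f y j \<le> -1" if "y \<notin> G n" for y j
    proof -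
      have y: "y \<notin> D" "y \<in> ball 0 (real n + 1)" using that by (auto simp: G_def)
      have "generator \<sigma> b \<pi> Q f y j \<le> generator \<sigma> b \<pi> Q V y j"
        by (rule generator_mono[of f, OF C2b GV(1)[OF y(1)] f(3) open_ball y(2)])
          (simp add: f_def \<phi>(4))
      with GV(2)[OF y(1)] show ?thesis by (rule order_trans[rotated])
    qed
    from expected_hitting_time_le[OF law C2b f(2) G this C]
    \<comment> \<open>Passing from \<open>f x i\<close> to \<open>V x i\<close> makes the bound
      independent of \<open>n\<close>.\<close>
    show ?thesis using f(3) ennreal_leI order_trans by blast
  qed
  have finite: "(\<integral>\<^sup>+ \<omega>. ?H \<omega> \<partial>P x i) < \<infinity>" for x i
  proof -
    have s: "sets (P x i) = sets skorohod_space" using law by (simp add: solves_martingale_problem_def)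
    then have space: "space (P x i) = space skorohod_space" by (rule sets_eq_imp_space_eq)
    have [measurable]: "hitting_time (G n \<times> UNIV) \<in> borel_measurable (P x i)" for n
      using hitting_time_measurable[OF G] by (simp add: s cong: measurable_cong_sets)
    \<comment> \<open>The sets \<open>G n\<close> shrink as \<open>n\<close> grows, so their hitting
      times increase.\<close>
    have "incseq ?F"
      unfolding incseq_def le_fun_def hitting_time_def G_def
      by (intro allI impI min.mono INF_superset_mono ennreal_leI) auto
    then have "(\<integral>\<^sup>+ \<omega>. (SUP n. ?F n \<omega>) \<partial>P x i) = (SUP n. \<integral>\<^sup>+ \<omega>. ?F n \<omega> \<partial>P x i)"
      by (rule nn_integral_monotone_convergence_SUP) measurable
    also have "\<dots> \<le> ennreal (V x i)" by (intro SUP_least truncated)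
    also have "\<dots> < \<infinity>" by simp
    finally have "(\<integral>\<^sup>+ \<omega>. (SUP n. ?F n \<omega>) \<partial>P x i) < \<infinity>" .
    moreover have "(\<integral>\<^sup>+ \<omega>. ?H \<omega> \<partial>P x i) \<le> (\<integral>\<^sup>+ \<omega>. (SUP n. ?F n \<omega>) \<partial>P x i)"
      unfolding G_def by (intro nn_integral_mono hitting_time_le_SUP space_skorohod) (simp add: space)
    ultimately show ?thesis by (rule le_less_trans[rotated])
  qed
  have "\<P>(\<omega> in P x i. ?H \<omega> < \<infinity>) = 1" for x i
  proof -
    interpret prob_space "P x i" using law by (simp add: solves_martingale_problem_def)
    have s: "sets (P x i) = sets skorohod_space" using law by (simp add: solves_martingale_problem_def)
    have [measurable]: "?H \<in> borel_measurable (P x i)"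
      using hitting_time_measurable[OF D] by (simp add: s cong: measurable_cong_sets)
    \<comment> \<open>A finite expectation forces almost sure finiteness, so recurrence follows from
      the moment bound.\<close>
    have "AE \<omega> in P x i. ?H \<omega> \<noteq> \<infinity>"
      using finite[of x i] by (intro nn_integral_noteq_infinite) auto
    then show ?thesis
      by (subst prob_Collect_eq_1) (auto simp: less_top)
  qed
  with finite show ?thesis
    by (simp add: positive_recurrent_def recurrent_def)
qed

end
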